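(* Let $\Delta$ be a tree. Then the following are equivalent: (i) $\Delta$ is a linear tree; (ii) $\Delta$ has the intersection property.
   Context: A simplicial complex $\Delta$ on a finite vertex set is a collection of subsets containing all singletons and closed under taking subsets; $\dim F=|F|-1$ for a face $F$ (so $\dim\emptyset=-1$). Facets are the maximal faces, $\mathcal F(\Delta)$ is the set of facets; $\dim\Delta$ is the maximal dimension of a facet, and $\Delta$ is pure if all facets have the same dimension. A subcomplex of $\Delta$ is a simplicial complex $\Gamma$ with $\mathcal F(\Gamma)\subseteq\mathcal F(\Delta)$. A chain between facets $F,G$ is a sequence of facets $F=F_0,\dots,F_q=G$ with $F_i\cap F_{i+1}\ne\emptyset$ for all $i$; $q$ is its length; it is proper if moreover $\dim(F_i\cap F_{i+1})=\dim(F_{i+1})-1$ for all $i$. A proper chain between $F$ and $G$ is irredundant if no subsequence of it except itself is a proper chain between $F$ and $G$. $\Delta$ is connected if any two facets are joined by a chain, and connected in codimension $1$ if for any two facets $F,G$ with $\dim F\ge\dim G$ there is a proper chain between $F$ and $G$. A facet $F$ is a leaf if it is the only facet of $\Delta$, or there is a facet $G\ne F$ with $F\cap H\subseteq F\cap G$ for every facet $H\ne F$. A tree is a connected simplicial complex every nonempty subcomplex of which has a leaf. In a pure tree connected in codimension $1$ there is a unique irredundant proper chain between any two facets $F,G$; its length is denoted $\operatorname{dist}(F,G)$. $\Delta$ has the intersection property if it is a pure tree (of dimension $d$, say), is connected in codimension $1$, and for any two facets $F,G$ with $\dim(F\cap G)=d-k$, $k=1,\dots,d+1$, one has $\operatorname{dist}(F,G)=k$.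 $K$ is a field, the vertices of $\Delta$ are identified with the variables of $R=K[x_1,\dots,x_n]$, and the facet ideal of $\Delta$ is generated by the monomials $x_{i_1}\cdots x_{i_s}$ with $\{x_{i_1},\dots,x_{i_s}\}$ a facet. A linear tree is a tree whose facet ideal has a linear resolution. *)

theory Defs
  imports
    "HOL-Library.Poly_Mapping"
    "HOL-Library.Sublist"
    "HOL-Algebra.Ideal"
    "Jordan_Normal_Form.Matrix"
begin

section \<open>Simplicial complexes\<close>

definition simplicial_complex :: "'v set \<Rightarrow> 'v set set \<Rightarrow> bool" where
  "simplicial_complex V \<Delta> \<longleftrightarrow>
     finite V \<and> \<Delta> \<subseteq> Pow V \<and> (\<forall>v\<in>V. {v} \<in> \<Delta>) \<and> (\<forall>F\<in>\<Delta>. \<forall>G. G \<subseteq> F \<longrightarrow> G \<in> \<Delta>)"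

definition face_dim :: "'v set \<Rightarrow> int" where
  "face_dim F = int (card F) - 1"

definition facets :: "'v set set \<Rightarrow> 'v set set" where
  "facets \<Delta> = {F \<in> \<Delta>. \<forall>G\<in>\<Delta>. F \<subseteq> G \<longrightarrow> G = F}"

definition complex_dim :: "'v set set \<Rightarrow> int" where
  "complex_dim \<Delta> = Max (face_dim ` facets \<Delta>)"

definition pure_complex :: "'v set set \<Rightarrow> bool" where
  "pure_complex \<Delta> \<longleftrightarrow> (\<forall>F\<in>facets \<Delta>. \<forall>G\<in>facets \<Delta>. face_dim F = face_dim G)"

text \<open>A subcomplex may live on a smaller vertex set.\<close>

definition is_subcomplex :: "'v set set \<Rightarrow> 'v set set \<Rightarrow> bool" where
  "is_subcomplex \<Gamma> \<Delta> \<longleftrightarrow> (\<exists>W. simplicial_complex W \<Gamma>) \<and> facets \<Gamma> \<subseteq> facets \<Delta>"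

text \<open>A chain \<open>F\<^sub>0, \<dots>, F\<^sub>q\<close> is a list with \<open>q + 1\<close> entries; its length as a chain is \<open>q\<close>.\<close>

definition is_chain :: "'v set set \<Rightarrow> 'v set \<Rightarrow> 'v set \<Rightarrow> 'v set list \<Rightarrow> bool" where
  "is_chain \<Delta> F G c \<longleftrightarrow>
     c \<noteq> [] \<and> set c \<subseteq> facets \<Delta> \<and> hd c = F \<and> last c = G \<and>
     (\<forall>i. Suc i < length c \<longrightarrow> c ! i \<inter> c ! Suc i \<noteq> {})"

definition chain_length :: "'v set list \<Rightarrow> nat" where
  "chain_length c = length c - 1"

definition proper_chain :: "'v set set \<Rightarrow> 'v set \<Rightarrow> 'v set \<Rightarrow> 'v set list \<Rightarrow> bool" where
  "proper_chain \<Delta> F G c \<longleftrightarrow>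
     is_chain \<Delta> F G c \<and>
     (\<forall>i. Suc i < length c \<longrightarrow> face_dim (c ! i \<inter> c ! Suc i) = face_dim (c ! Suc i) - 1)"

definition irredundant_proper_chain ::
    "'v set set \<Rightarrow> 'v set \<Rightarrow> 'v set \<Rightarrow> 'v set list \<Rightarrow> bool" where
  "irredundant_proper_chain \<Delta> F G c \<longleftrightarrow>
     proper_chain \<Delta> F G c \<and> (\<forall>c'. subseq c' c \<and> proper_chain \<Delta> F G c' \<longrightarrow> c' = c)"

definition connected_complex :: "'v set set \<Rightarrow> bool" where
  "connected_complex \<Delta> \<longleftrightarrow> (\<forall>F\<in>facets \<Delta>. \<forall>G\<in>facets \<Delta>. \<exists>c. is_chain \<Delta> F G c)"

definition connected_codim_one :: "'v set set \<Rightarrow> bool" where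
  "connected_codim_one \<Delta> \<longleftrightarrow>
     (\<forall>F\<in>facets \<Delta>. \<forall>G\<in>facets \<Delta>. face_dim F \<ge> face_dim G \<longrightarrow> (\<exists>c. proper_chain \<Delta> F G c))"

definition is_leaf :: "'v set set \<Rightarrow> 'v set \<Rightarrow> bool" where
  "is_leaf \<Delta> F \<longleftrightarrow>
     F \<in> facets \<Delta> \<and>
     (facets \<Delta> = {F} \<or>
      (\<exists>G\<in>facets \<Delta>. G \<noteq> F \<and> (\<forall>H\<in>facets \<Delta>. H \<noteq> F \<longrightarrow> F \<inter> H \<subseteq> F \<inter> G)))"

definition is_tree :: "'v set \<Rightarrow> 'v set set \<Rightarrow> bool" where
  "is_tree V \<Delta> \<longleftrightarrow>
     simplicial_complex V \<Delta> \<and> connected_complex \<Delta> \<and>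
     (\<forall>\<Gamma>. is_subcomplex \<Gamma> \<Delta> \<and> \<Gamma> \<noteq> {} \<longrightarrow> (\<exists>F. is_leaf \<Gamma> F))"

text \<open>The following is meaningful for pure trees connected in codimension 1, where the
  irredundant proper chain between two facets exists and is unique.\<close>

definition facet_dist :: "'v set set \<Rightarrow> 'v set \<Rightarrow> 'v set \<Rightarrow> nat" where
  "facet_dist \<Delta> F G = chain_length (THE c. irredundant_proper_chain \<Delta> F G c)"

definition intersection_property :: "'v set \<Rightarrow> 'v set set \<Rightarrow> bool" where
  "intersection_property V \<Delta> \<longleftrightarrow>
     is_tree V \<Delta> \<and> pure_complex \<Delta> \<and> connected_codim_one \<Delta> \<and>
     (\<forall>F\<in>facets \<Delta>. \<forall>G\<in>facets \<Delta>. \<forall>k::nat.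
        1 \<le> k \<and> int k \<le> complex_dim \<Delta> + 1 \<and> face_dim (F \<inter> G) = complex_dim \<Delta> - int k \<longrightarrow>
        facet_dist \<Delta> F G = k)"

section \<open>Polynomials in the variables \<open>V\<close> and facet ideals\<close>

text \<open>A monomial is a finitely supported exponent function, and a polynomial is a finitely
  supported coefficient function on monomials.\<close>

type_synonym ('v, 'k) mpoly = "('v \<Rightarrow>\<^sub>0 nat) \<Rightarrow>\<^sub>0 'k"

definition poly_ring :: "'v set \<Rightarrow> ('v, 'k::field) mpoly ring" where
  "poly_ring V =
     \<lparr>carrier = {p. \<forall>m\<in>Poly_Mapping.keys p. Poly_Mapping.keys m \<subseteq> V},
      monoid.mult = (*), one = 1, zero = 0, add = (+)\<rparr>"

definition indet :: "'v \<Rightarrow> ('v, 'k::field) mpoly" where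
  "indet v = Poly_Mapping.single (Poly_Mapping.single v 1) 1"

lemma cring_poly_ring: "cring (poly_ring V :: ('v, 'k::field) mpoly ring)"
proof -
  let ?R = "poly_ring V :: ('v, 'k) mpoly ring"
  have mult_closed: "p * q \<in> carrier ?R" if "p \<in> carrier ?R" "q \<in> carrier ?R" for p q
  proof -
    have "Poly_Mapping.keys m \<subseteq> V" if m: "m \<in> Poly_Mapping.keys (p * q)" for m
    proof -
      obtain a c where m': "m = a + c" "a \<in> Poly_Mapping.keys p" "c \<in> Poly_Mapping.keys q"
        using m keys_mult[of p q] by blast
      then have "Poly_Mapping.keys a \<subseteq> V" "Poly_Mapping.keys c \<subseteq> V"
        using \<open>p \<in> carrier ?R\<close> \<open>q \<in> carrier ?R\<close> by (auto simp: poly_ring_def)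
      then show ?thesis
        using m' keys_add[of a c] by auto
    qed
    then show ?thesis
      by (simp add: poly_ring_def)
  qed
  have add_closed: "p + q \<in> carrier ?R" if "p \<in> carrier ?R" "q \<in> carrier ?R" for p q
    using that keys_add[of p q] by (fastforce simp: poly_ring_def)
  have one_closed: "1 \<in> carrier ?R" and zero_closed: "0 \<in> carrier ?R"
    by (simp_all add: poly_ring_def)
  have minus_closed: "- p \<in> carrier ?R" if "p \<in> carrier ?R" for p
    using that by (simp add: poly_ring_def)
  have ops: "monoid.mult ?R = (*)" "one ?R = 1" "zero ?R = 0" "add ?R = (+)"
    by (simp_all add: poly_ring_def)
  show ?thesis
  proof (rule cringI)
    show "abelian_group ?R"
    proof (rule abelian_groupI)
      fix p assume "p \<in> carrier ?R"
      then show "\<exists>q\<in>carrier ?R. q \<oplus>\<^bsub>?R\<^esub> p = \<zero>\<^bsub>?R\<^esub>"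
        using minus_closed[of p] by (intro bexI[of _ "- p"]) (simp_all add: ops)
    qed (simp_all add: ops add_closed zero_closed add.assoc add.commute)
    show "Group.comm_monoid ?R"
      by (rule comm_monoidI) (simp_all add: ops mult_closed one_closed mult.assoc mult.commute)
  qed (simp add: ops distrib_right)
qed

lemma indet_in_poly_ring: "v \<in> V \<Longrightarrow> indet v \<in> carrier (poly_ring V)"
  by (simp add: indet_def poly_ring_def)

definition facet_ideal :: "'v set \<Rightarrow> 'v set set \<Rightarrow> ('v, 'k::field) mpoly set" where
  "facet_ideal V \<Delta> = Idl\<^bsub>poly_ring V\<^esub> ((\<lambda>F. \<Prod>v\<in>F. indet v) ` facets \<Delta>)"

definition mon_degree :: "('v \<Rightarrow>\<^sub>0 nat) \<Rightarrow> nat" where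
  "mon_degree m = (\<Sum>v\<in>Poly_Mapping.keys m. Poly_Mapping.lookup m v)"

text \<open>The zero polynomial is homogeneous of every degree, and it is the only polynomial that is
  homogeneous of a negative degree.\<close>

definition homogeneous :: "int \<Rightarrow> ('v, 'k::field) mpoly \<Rightarrow> bool" where
  "homogeneous e p \<longleftrightarrow> (\<forall>m\<in>Poly_Mapping.keys p. int (mon_degree m) = e)"

section \<open>Linear resolutions\<close>

definition free_mod :: "'v set \<Rightarrow> nat \<Rightarrow> ('v, 'k::field) mpoly Matrix.vec set" where
  "free_mod V r = {u \<in> carrier_vec r. \<forall>j<r. u $ j \<in> carrier (poly_ring V)}"

text \<open>With \<open>R = poly_ring V\<close>, the data \<open>b\<close>, \<open>a\<close>, \<open>g\<close>, \<open>D\<close> describe a complex of graded free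
  \<open>R\<close>-modules
    \<open>\<dots> \<rightarrow> F\<^sub>2 \<rightarrow> F\<^sub>1 \<rightarrow> F\<^sub>0 \<rightarrow> I \<rightarrow> 0\<close>
  where \<open>F\<^sub>i\<close> has rank \<open>b i\<close> and is the direct sum of the \<open>R(- a i j)\<close> for \<open>j < b i\<close>, i.e. its
  \<open>j\<close>-th basis element has degree \<open>a i j\<close>. The augmentation \<open>F\<^sub>0 \<rightarrow> I\<close> maps the basis to the
  entries of \<open>g\<close>, and \<open>D i\<close> is the matrix of \<open>F\<^bsub>i+1\<^esub> \<rightarrow> F\<^sub>i\<close>; the homogeneity conditions say that
  these maps have degree 0. The ranks may eventually be 0, so finite resolutions are covered.\<close>

definition graded_free_resolution ::
    "'v set \<Rightarrow> ('v, 'k::field) mpoly set \<Rightarrow> (nat \<Rightarrow> nat) \<Rightarrow> (nat \<Rightarrow> nat \<Rightarrow> int) \<Rightarrow>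
     ('v, 'k) mpoly Matrix.vec \<Rightarrow> (nat \<Rightarrow> ('v, 'k) mpoly Matrix.mat) \<Rightarrow> bool" where
  "graded_free_resolution V I b a g D \<longleftrightarrow>
     g \<in> free_mod V (b 0) \<and>
     (\<forall>j<b 0. homogeneous (a 0 j) (g $ j)) \<and>
     (\<forall>i. D i \<in> carrier_mat (b i) (b (Suc i))) \<and>
     (\<forall>i. \<forall>j<b i. \<forall>k<b (Suc i).
        D i $$ (j, k) \<in> carrier (poly_ring V) \<and>
        homogeneous (a (Suc i) k - a i j) (D i $$ (j, k))) \<and>
     (\<lambda>u. g \<bullet> u) ` free_mod V (b 0) = I \<and>
     (\<lambda>u. D 0 *\<^sub>v u) ` free_mod V (b 1) = {u \<in> free_mod V (b 0). g \<bullet> u = 0} \<and>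
     (\<forall>i. (\<lambda>u. D (Suc i) *\<^sub>v u) ` free_mod V (b (Suc (Suc i))) =
          {u \<in> free_mod V (b (Suc i)). D i *\<^sub>v u = 0\<^sub>v (b i)})"

text \<open>Minimality: the image of \<open>F\<^bsub>i+1\<^esub>\<close> lies in \<open>\<mm> F\<^sub>i\<close> for the irrelevant ideal \<open>\<mm>\<close>, i.e. all
  entries of the matrices have constant coefficient 0.\<close>

definition minimal_graded_free_resolution ::
    "'v set \<Rightarrow> ('v, 'k::field) mpoly set \<Rightarrow> (nat \<Rightarrow> nat) \<Rightarrow> (nat \<Rightarrow> nat \<Rightarrow> int) \<Rightarrow>
     ('v, 'k) mpoly Matrix.vec \<Rightarrow> (nat \<Rightarrow> ('v, 'k) mpoly Matrix.mat) \<Rightarrow> bool" where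
  "minimal_graded_free_resolution V I b a g D \<longleftrightarrow>
     graded_free_resolution V I b a g D \<and>
     (\<forall>i. \<forall>j<b i. \<forall>k<b (Suc i). Poly_Mapping.lookup (D i $$ (j, k)) 0 = 0)"

text \<open>\<open>F\<^sub>i = R(-d-i)\<^bsup>b i\<^esup>\<close> for some \<open>d\<close> and all \<open>i\<close> in the minimal graded free resolution of \<open>I\<close>
  (which is unique up to isomorphism).\<close>

definition has_linear_resolution :: "'v set \<Rightarrow> ('v, 'k::field) mpoly set \<Rightarrow> bool" where
  "has_linear_resolution V I \<longleftrightarrow>
     (\<exists>b a g D. minimal_graded_free_resolution V I b a g D \<and>
        (\<exists>d::int. \<forall>i. \<forall>j<b i. a i j = d + int i))"

definition linear_tree :: "'k::field itself \<Rightarrow> 'v set \<Rightarrow> 'v set set \<Rightarrow> bool" where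
  "linear_tree K V \<Delta> \<longleftrightarrow>
     is_tree V \<Delta> \<and> has_linear_resolution V (facet_ideal V \<Delta> :: ('v, 'k) mpoly set)"

end

theory Submission
  imports Defs
begin

text \<open>A linear resolution forces any two facets \<open>F\<close>, \<open>G\<close> to be joined by a path of facets inside
  \<open>F \<union> G\<close> with consecutive intersections of codimension one; this only uses the linearity of the
  first syzygies. In a tree, paths without shortcuts are unique and every vertex occurs on an interval
  of such a path, so that a path inside \<open>F \<union> G\<close> gains one vertex of \<open>G - F\<close> in each step and
  has length \<open>|G - F|\<close>.

  Conversely, if the distance of \<open>F\<close> and \<open>G\<close> is \<open>|G - F|\<close>, the first step of the path from \<open>F\<close>
  adds a vertex of \<open>G\<close>. Leaves are never interior to a path, so ordering the facets by successive
  removal of leaves gives linear quotients: all successive colon ideals are generated by variables.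
  This property is inherited by the leading ideals of the iterated syzygy modules, which yields the
  matrices of a linear resolution one by one.\<close>

section \<open>Monomials and homogeneous polynomials\<close>

text \<open>The paths live in the graph whose vertices are the facets and whose edges are the
  codimension-one intersections. In every subfamily the neighbours of a leaf are pairwise adjacent,
  so this graph is chordal; the members of a triangle share one face of size \<open>n - 1\<close>,
  so there is no induced diamond. Chordal graphs without induced diamonds are block graphs, and
  chordless paths in block graphs are determined by their ends. This gives sense to
  \<open>facet_dist\<close>, which is a definite description and says nothing until uniqueness is
  proved. A linear resolution is an infinite sequence of explicit matrices. They are found by
  dependent choice; what makes the choice possible at each stage is that the columns reduce every
  element of their span by division. All matrix entries are linear forms, so minimality follows at
  once. In the other direction the generators \<open>g\<close> and the matrix \<open>D 0\<close> are
  arbitrary, and only their degrees are known. The argument therefore compares coefficients at the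
  single monomial of \<open>F \<union> G\<close>.\<close>

definition face_mon :: "'v set \<Rightarrow> 'v \<Rightarrow>\<^sub>0 nat" where
  "face_mon F = (\<Sum>v\<in>F. Poly_Mapping.single v 1)"

lemma lookup_face_mon: "finite F \<Longrightarrow> Poly_Mapping.lookup (face_mon F) v = (if v \<in> F then 1 else 0)"
  by (induction F rule: finite_induct) (auto simp: face_mon_def lookup_add lookup_single when_def)

lemma keys_face_mon: "finite F \<Longrightarrow> Poly_Mapping.keys (face_mon F) = F"
  by (auto simp: in_keys_iff lookup_face_mon split: if_splits)

lemma keys_add_nat: "Poly_Mapping.keys (a + b :: 'v \<Rightarrow>\<^sub>0 nat) = Poly_Mapping.keys a \<union> Poly_Mapping.keys b"
  by (auto simp: in_keys_iff lookup_add)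

lemma face_mon_dvd:
  assumes "finite F" "F \<subseteq> Poly_Mapping.keys m"
  obtains m' where "m = face_mon F + m'"
proof -
  have "m = face_mon F + (m - face_mon F)"
  proof (rule poly_mapping_eqI)
    fix v
    have "v \<in> F \<Longrightarrow> Poly_Mapping.lookup m v \<noteq> 0"
      using assms by (auto simp: in_keys_iff)
    then show "Poly_Mapping.lookup m v = Poly_Mapping.lookup (face_mon F + (m - face_mon F)) v"
      using assms by (auto simp: lookup_add lookup_minus lookup_face_mon)
  qed
  then show ?thesis by (rule that)
qed

lemma face_mon_singleton: "face_mon {v} = Poly_Mapping.single v 1"
  by (simp add: face_mon_def)

lemma face_mon_Un_disjoint:
  "finite F \<Longrightarrow> finite G \<Longrightarrow> F \<inter> G = {} \<Longrightarrow> face_mon (F \<union> G) = face_mon F + face_mon G"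
  by (simp add: face_mon_def sum.union_disjoint)

lemma mon_degree_sum:
  assumes "finite A" "Poly_Mapping.keys m \<subseteq> A"
  shows "mon_degree m = (\<Sum>v\<in>A. Poly_Mapping.lookup m v)"
  unfolding mon_degree_def using assms
  by (intro sum.mono_neutral_left) (auto simp: in_keys_iff)

lemma mon_degree_add: "mon_degree (a + b) = mon_degree a + mon_degree b"
proof -
  let ?A = "Poly_Mapping.keys a \<union> Poly_Mapping.keys b"
  show ?thesis
    by (simp add: mon_degree_sum[of ?A] keys_add_nat lookup_add sum.distrib)
qed

lemma mon_degree_face_mon: "finite F \<Longrightarrow> mon_degree (face_mon F) = card F"
  by (simp add: mon_degree_def keys_face_mon lookup_face_mon)

lemma mon_degree_single: "mon_degree (Poly_Mapping.single v 1) = 1"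
  by (simp add: mon_degree_def)

lemma homogeneous_zero [simp]: "homogeneous e 0"
  by (simp add: homogeneous_def)

lemma homogeneous_uminus [simp]: "homogeneous e (- p) \<longleftrightarrow> homogeneous e p"
  by (simp add: homogeneous_def in_keys_iff)

lemma homogeneous_add: "homogeneous e p \<Longrightarrow> homogeneous e q \<Longrightarrow> homogeneous e (p + q)"
  using keys_add[of p q] by (auto simp: homogeneous_def)

lemma homogeneous_diff: "homogeneous e p \<Longrightarrow> homogeneous e q \<Longrightarrow> homogeneous e (p - q)"
  using homogeneous_add[of e p "- q"] by simp

lemma homogeneous_sum: "(\<And>i. i \<in> A \<Longrightarrow> homogeneous e (f i)) \<Longrightarrow> homogeneous e (sum f A)"
  by (induction A rule: infinite_finite_induct) (auto intro: homogeneous_add)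

lemma homogeneous_mult:
  assumes "homogeneous e p" "homogeneous f q"
  shows "homogeneous (e + f) (p * q)"
  unfolding homogeneous_def
proof
  fix m assume "m \<in> Poly_Mapping.keys (p * q)"
  then obtain a b where "m = a + b" "a \<in> Poly_Mapping.keys p" "b \<in> Poly_Mapping.keys q"
    using keys_mult[of p q] by blast
  then show "int (mon_degree m) = e + f"
    using assms by (simp add: homogeneous_def mon_degree_add)
qed

lemma homogeneous_indet: "homogeneous 1 (indet v)"
  by (simp add: homogeneous_def indet_def mon_degree_def)

lemma prod_indet:
  "finite F \<Longrightarrow> (\<Prod>v\<in>F. indet v :: ('v, 'k::field) mpoly) = Poly_Mapping.single (face_mon F) 1"
  by (induction F rule: finite_induct) (simp_all add: face_mon_def indet_def mult_single)

lemma poly_ring_simps: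
  "p \<oplus>\<^bsub>poly_ring V\<^esub> q = p + q" "p \<otimes>\<^bsub>poly_ring V\<^esub> q = p * q" "\<zero>\<^bsub>poly_ring V\<^esub> = 0"
  by (simp_all add: poly_ring_def)

lemma poly_ring_iff:
  "p \<in> carrier (poly_ring V) \<longleftrightarrow> (\<forall>m\<in>Poly_Mapping.keys p. Poly_Mapping.keys m \<subseteq> V)"
  by (simp add: poly_ring_def)

lemma poly_ring_zero [simp]: "0 \<in> carrier (poly_ring V)"
  by (simp add: poly_ring_iff)

lemma poly_ring_uminus [simp]: "- p \<in> carrier (poly_ring V) \<longleftrightarrow> p \<in> carrier (poly_ring V)"
  by (simp add: poly_ring_iff in_keys_iff)

lemma poly_ring_add:
  "p \<in> carrier (poly_ring V) \<Longrightarrow> q \<in> carrier (poly_ring V) \<Longrightarrow> p + q \<in> carrier (poly_ring V)"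
  using keys_add[of p q] by (fastforce simp: poly_ring_iff)

lemma poly_ring_diff:
  "p \<in> carrier (poly_ring V) \<Longrightarrow> q \<in> carrier (poly_ring V) \<Longrightarrow> p - q \<in> carrier (poly_ring V)"
  using poly_ring_add[of p V "- q"] by simp

lemma poly_ring_mult:
  assumes "p \<in> carrier (poly_ring V)" "q \<in> carrier (poly_ring V)"
  shows "p * q \<in> carrier (poly_ring V)"
  using assms cring.cring_simprules(5)[OF cring_poly_ring, of p V q] by (simp add: poly_ring_simps)

lemma poly_ring_sum:
  "(\<And>i. i \<in> A \<Longrightarrow> f i \<in> carrier (poly_ring V)) \<Longrightarrow> sum f A \<in> carrier (poly_ring V)"
  by (induction A rule: infinite_finite_induct) (auto intro: poly_ring_add)

lemma single_face_mon_in_poly_ring: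
  "finite F \<Longrightarrow> F \<subseteq> V \<Longrightarrow> Poly_Mapping.single (face_mon F) c \<in> carrier (poly_ring V)"
  by (simp add: poly_ring_iff keys_face_mon)

lemma poly_mapping_sum_singles:
  "p = (\<Sum>m\<in>Poly_Mapping.keys p. Poly_Mapping.single m (Poly_Mapping.lookup p m))"
proof (rule poly_mapping_eqI)
  fix k
  show "Poly_Mapping.lookup p k = Poly_Mapping.lookup
      (\<Sum>m\<in>Poly_Mapping.keys p. Poly_Mapping.single m (Poly_Mapping.lookup p m)) k"
    by (simp add: lookup_sum lookup_single when_def in_keys_iff)
qed

lemma lookup_single_mult_add:
  fixes p :: "('v, 'k::field) mpoly"
  shows "Poly_Mapping.lookup (Poly_Mapping.single a c * p) (a + m) = c * Poly_Mapping.lookup p m"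
proof -
  have "Poly_Mapping.single a c * p =
      (\<Sum>x\<in>Poly_Mapping.keys p. Poly_Mapping.single (a + x) (c * Poly_Mapping.lookup p x))"
    by (subst (1) poly_mapping_sum_singles[of p]) (simp add: sum_distrib_left mult_single)
  then show ?thesis
    by (simp add: lookup_sum lookup_single when_def in_keys_iff)
qed

lemma keys_single_mult_add:
  fixes p :: "('v, 'k::field) mpoly"
  shows "m \<in> Poly_Mapping.keys p \<Longrightarrow> a + m \<in> Poly_Mapping.keys (Poly_Mapping.single a 1 * p)"
  by (simp add: in_keys_iff lookup_single_mult_add)

lemma keys_single_mult:
  fixes p :: "('v, 'k::field) mpoly"
  assumes "m \<in> Poly_Mapping.keys (Poly_Mapping.single a c * p)"
  obtains m' where "m = a + m'" "m' \<in> Poly_Mapping.keys p"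
  using assms keys_mult[of "Poly_Mapping.single a c" p] by (auto split: if_splits)

lemma keys_sum_mem:
  assumes "m \<in> Poly_Mapping.keys (sum f A)"
  obtains i where "i \<in> A" "m \<in> Poly_Mapping.keys (f i)"
  using assms
proof (induction A arbitrary: thesis rule: infinite_finite_induct)
  case (insert x A)
  then show ?case
    using keys_add[of "f x" "sum f A"] by auto
qed auto

text \<open>Group the monomials of \<open>p\<close> by a chosen divisor \<open>t k\<close> and let
  \<open>q k\<close> collect the cofactors. Through the second conclusion the variables and degrees
  of \<open>q k\<close> are controlled by those of \<open>p\<close>.\<close>

lemma divide_by_monomials:
  fixes p :: "('v, 'k::field) mpoly" and t :: "'i \<Rightarrow> 'v \<Rightarrow>\<^sub>0 nat"
  assumes "finite K"
    and "\<And>m. m \<in> Poly_Mapping.keys p \<Longrightarrow> \<exists>k\<in>K. \<exists>m'. m = t k + m'"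
  obtains q where "p = (\<Sum>k\<in>K. Poly_Mapping.single (t k) 1 * q k)"
    "\<And>k m. m \<in> Poly_Mapping.keys (q k) \<Longrightarrow> t k + m \<in> Poly_Mapping.keys p"
proof -
  obtain \<kappa> \<mu> where km: "\<And>m. m \<in> Poly_Mapping.keys p \<Longrightarrow> \<kappa> m \<in> K \<and> m = t (\<kappa> m) + \<mu> m"
    using assms(2) by metis
  define q where "q k = (\<Sum>m\<in>{m\<in>Poly_Mapping.keys p. \<kappa> m = k}.
      Poly_Mapping.single (\<mu> m) (Poly_Mapping.lookup p m))" for k
  have "(\<Sum>k\<in>K. Poly_Mapping.single (t k) 1 * q k) =
      (\<Sum>k\<in>K. \<Sum>m\<in>{m\<in>Poly_Mapping.keys p. \<kappa> m = k}. Poly_Mapping.single m (Poly_Mapping.lookup p m))"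
    unfolding q_def sum_distrib_left
  proof (intro sum.cong refl)
    fix k m assume "m \<in> {m\<in>Poly_Mapping.keys p. \<kappa> m = k}"
    then have "m = t k + \<mu> m" using km by auto
    then show "Poly_Mapping.single (t k) 1 * Poly_Mapping.single (\<mu> m) (Poly_Mapping.lookup p m) =
        Poly_Mapping.single m (Poly_Mapping.lookup p m)"
      by (simp add: mult_single)
  qed
  also have "\<dots> = (\<Sum>m\<in>Poly_Mapping.keys p. Poly_Mapping.single m (Poly_Mapping.lookup p m))"
    using km assms(1) by (intro sum.group) auto
  also have "\<dots> = p"
    by (rule poly_mapping_sum_singles[symmetric])
  finally have "p = (\<Sum>k\<in>K. Poly_Mapping.single (t k) 1 * q k)" by simp
  moreover have "t k + m \<in> Poly_Mapping.keys p" if m: "m \<in> Poly_Mapping.keys (q k)" for k m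
  proof -
    from m obtain m' where "m' \<in> Poly_Mapping.keys p" "\<kappa> m' = k" "m = \<mu> m'"
      unfolding q_def by (elim keys_sum_mem) (auto split: if_splits)
    then show ?thesis using km by force
  qed
  ultimately show ?thesis by (rule that)
qed

section \<open>Facet ideals are monomial ideals\<close>

text \<open>The polynomials on the right form an ideal containing the generators, and division by
  the generators puts each of them into \<open>facet_ideal\<close>. From here on membership is
  tested monomial by monomial.\<close>

lemma facet_ideal_iff:
  fixes p :: "('v, 'k::field) mpoly"
  assumes "simplicial_complex V \<Delta>"
  shows "p \<in> facet_ideal V \<Delta> \<longleftrightarrow> p \<in> carrier (poly_ring V) \<and>
    (\<forall>m\<in>Poly_Mapping.keys p. \<exists>F\<in>facets \<Delta>. F \<subseteq> Poly_Mapping.keys m)"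
    (is "_ \<longleftrightarrow> p \<in> carrier ?R \<and> ?P p")
proof -
  let ?gen = "\<lambda>F. \<Prod>v\<in>F. indet v :: ('v, 'k) mpoly"
  interpret R: cring ?R by (rule cring_poly_ring)
  have fin: "finite F" and sub: "F \<subseteq> V" if "F \<in> facets \<Delta>" for F
    using that assms finite_subset[of F V] by (auto simp: simplicial_complex_def facets_def)
  have finF: "finite (facets \<Delta>)"
    using assms by (auto simp: simplicial_complex_def facets_def intro: finite_subset[of _ "Pow V"])
  have gen: "?gen F = Poly_Mapping.single (face_mon F) 1" if "F \<in> facets \<Delta>" for F
    using fin[OF that] by (rule prod_indet)
  have carr: "?gen ` facets \<Delta> \<subseteq> carrier ?R"
    using fin sub by (auto simp: gen intro: single_face_mon_in_poly_ring)
  have fi: "facet_ideal V \<Delta> = Idl\<^bsub>?R\<^esub> (?gen ` facets \<Delta>)"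
    by (simp add: facet_ideal_def)
  have mult_P: "?P (a * x)" if "?P x" for a x :: "('v, 'k) mpoly"
  proof
    fix m assume "m \<in> Poly_Mapping.keys (a * x)"
    then obtain b c where "m = b + c" "c \<in> Poly_Mapping.keys x"
      using keys_mult[of a x] by blast
    moreover from this that obtain F where "F \<in> facets \<Delta>" "F \<subseteq> Poly_Mapping.keys c"
      by blast
    ultimately show "\<exists>F\<in>facets \<Delta>. F \<subseteq> Poly_Mapping.keys m"
      by (auto simp: keys_add_nat)
  qed
  have "ideal {x \<in> carrier ?R. ?P x} ?R"
  proof (rule idealI)
    show "ring ?R" by (rule R.ring_axioms)
    show "subgroup {x \<in> carrier ?R. ?P x} (add_monoid ?R)"
    proof (rule subgroup.intro)
      fix x assume x: "x \<in> {x \<in> carrier ?R. ?P x}"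
      then have "- x \<in> {x \<in> carrier ?R. ?P x}" by (simp add: in_keys_iff)
      moreover have "inv\<^bsub>add_monoid ?R\<^esub> x = - x"
      proof -
        have "\<ominus>\<^bsub>?R\<^esub> x = - x"
          by (rule R.minus_equality) (use x in \<open>auto simp: poly_ring_simps\<close>)
        then show ?thesis by (simp add: a_inv_def)
      qed
      ultimately show "inv\<^bsub>add_monoid ?R\<^esub> x \<in> {x \<in> carrier ?R. ?P x}" by simp
    next
      fix x y assume "x \<in> {x \<in> carrier ?R. ?P x}" "y \<in> {x \<in> carrier ?R. ?P x}"
      then show "x \<otimes>\<^bsub>add_monoid ?R\<^esub> y \<in> {x \<in> carrier ?R. ?P x}"
        using keys_add[of x y] poly_ring_add[of x V y] by (simp add: poly_ring_simps) blast
    qed (auto simp: poly_ring_simps)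
  next
    fix a x assume "a \<in> {x \<in> carrier ?R. ?P x}" "x \<in> carrier ?R"
    then show "x \<otimes>\<^bsub>?R\<^esub> a \<in> {x \<in> carrier ?R. ?P x}" "a \<otimes>\<^bsub>?R\<^esub> x \<in> {x \<in> carrier ?R. ?P x}"
      using mult_P[of a x] by (auto simp: poly_ring_simps poly_ring_mult mult.commute)
  qed
  moreover have "?gen ` facets \<Delta> \<subseteq> {x \<in> carrier ?R. ?P x}"
    using carr fin by (auto simp: gen keys_face_mon)
  ultimately have 1: "facet_ideal V \<Delta> \<subseteq> {x \<in> carrier ?R. ?P x}"
    unfolding fi by (rule R.genideal_minimal)
  have "p \<in> facet_ideal V \<Delta>" if p: "p \<in> carrier ?R" "?P p"
  proof -
    interpret I: ideal "facet_ideal V \<Delta> :: ('v, 'k) mpoly set" ?R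
      unfolding fi using carr by (rule R.genideal_ideal)
    have "\<exists>F\<in>facets \<Delta>. \<exists>m'. m = face_mon F + m'" if "m \<in> Poly_Mapping.keys p" for m
      using p(2) that fin by (metis face_mon_dvd)
    from divide_by_monomials[OF finF this] obtain q where
      q: "p = (\<Sum>F\<in>facets \<Delta>. Poly_Mapping.single (face_mon F) 1 * q F)"
      "\<And>F m. m \<in> Poly_Mapping.keys (q F) \<Longrightarrow> face_mon F + m \<in> Poly_Mapping.keys p"
      by blast
    have "q F \<in> carrier ?R" for F
      unfolding poly_ring_iff
    proof
      fix m assume "m \<in> Poly_Mapping.keys (q F)"
      from p(1) q(2)[OF this] have "Poly_Mapping.keys (face_mon F + m) \<subseteq> V"
        by (simp add: poly_ring_iff)
      then show "Poly_Mapping.keys m \<subseteq> V"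
        by (simp add: keys_add_nat)
    qed
    moreover have "?gen F \<in> facet_ideal V \<Delta>" if "F \<in> facets \<Delta>" for F
      unfolding fi using R.genideal_self[OF carr] that by blast
    ultimately have *: "Poly_Mapping.single (face_mon F) 1 * q F \<in> facet_ideal V \<Delta>" if "F \<in> facets \<Delta>" for F
      using I.I_r_closed[of "?gen F" "q F"] that by (simp add: poly_ring_simps gen)
    have zero: "(0 :: ('v, 'k) mpoly) \<in> facet_ideal V \<Delta>"
      using I.zero_closed by (simp add: poly_ring_simps)
    have add: "x + y \<in> facet_ideal V \<Delta>"
      if "x \<in> facet_ideal V \<Delta>" "y \<in> facet_ideal V \<Delta>" for x y :: "('v, 'k) mpoly"
      using I.a_closed[OF that] by (simp add: poly_ring_simps)
    have "(\<Sum>F\<in>A. Poly_Mapping.single (face_mon F) 1 * q F) \<in> facet_ideal V \<Delta>" if "A \<subseteq> facets \<Delta>" for A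
      using that by (induction A rule: infinite_finite_induct) (auto intro: zero add *)
    then show ?thesis unfolding q(1) by simp
  qed
  with 1 show ?thesis by blast
qed

section \<open>Linear resolutions from pivoted matrices\<close>

lemma index_mult_mat_vec_sum:
  assumes "A \<in> carrier_mat r s" "u \<in> carrier_vec s" "i < r"
  shows "(A *\<^sub>v u) $ i = (\<Sum>k<s. A $$ (i, k) * u $ k)"
  using assms by (auto simp: scalar_prod_def lessThan_atLeast0 intro!: sum.cong)

lemma free_mod_carrier: "u \<in> free_mod V r \<Longrightarrow> u \<in> carrier_vec r"
  and free_mod_index: "u \<in> free_mod V r \<Longrightarrow> j < r \<Longrightarrow> u $ j \<in> carrier (poly_ring V)"
  by (simp_all add: free_mod_def)

lemma free_mod_zero: "0\<^sub>v r \<in> free_mod V r"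
  by (simp add: free_mod_def)

lemma free_mod_add:
  assumes u: "u \<in> free_mod V r" and v: "v \<in> free_mod V r"
  shows "u + v \<in> free_mod V r"
proof -
  have dim: "dim_vec u = r" "dim_vec v = r" using u v by (simp_all add: free_mod_def)
  show ?thesis
    unfolding free_mod_def carrier_vec_def
    using dim poly_ring_add[OF free_mod_index[OF u] free_mod_index[OF v]] by simp
qed

lemma free_mod_diff:
  assumes u: "u \<in> free_mod V r" and v: "v \<in> free_mod V r"
  shows "u - v \<in> free_mod V r"
proof -
  have dim: "dim_vec u = r" "dim_vec v = r" using u v by (simp_all add: free_mod_def)
  show ?thesis
    unfolding free_mod_def carrier_vec_def
    using dim poly_ring_diff[OF free_mod_index[OF u] free_mod_index[OF v]] by simp
qed

lemma free_mod_mult_mat_vec: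
  assumes "D \<in> carrier_mat r s" "\<And>i k. i < r \<Longrightarrow> k < s \<Longrightarrow> D $$ (i, k) \<in> carrier (poly_ring V)"
    and "v \<in> free_mod V s"
  shows "D *\<^sub>v v \<in> free_mod V r"
  unfolding free_mod_def
proof (intro CollectI conjI allI impI)
  show "D *\<^sub>v v \<in> carrier_vec r"
    using assms(1) free_mod_carrier[OF assms(3)] by (rule mult_mat_vec_carrier)
  show "(D *\<^sub>v v) $ i \<in> carrier (poly_ring V)" if "i < r" for i
    unfolding index_mult_mat_vec_sum[OF assms(1) free_mod_carrier[OF assms(3)] that]
    using assms(2,3) that by (intro poly_ring_sum poly_ring_mult free_mod_index) auto
qed

text \<open>The columns of such a matrix behave like a Groebner basis with respect to a position-over-term
  order: column \<open>k\<close> has its last nonzero entry, a variable, in row \<open>fst (ps ! k)\<close>.\<close>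

definition pivoted :: "'v set \<Rightarrow> nat \<Rightarrow> (nat \<times> 'v) list \<Rightarrow> ('v, 'k::field) mpoly Matrix.mat \<Rightarrow> bool" where
  "pivoted V r ps D \<longleftrightarrow>
     D \<in> carrier_mat r (length ps) \<and> distinct ps \<and> sorted (map fst ps) \<and>
     (\<forall>(j, w)\<in>set ps. j < r \<and> w \<in> V) \<and>
     (\<forall>k<length ps.
        (\<forall>i<r. D $$ (i, k) \<in> carrier (poly_ring V) \<and> homogeneous 1 (D $$ (i, k))) \<and>
        D $$ (fst (ps ! k), k) = indet (snd (ps ! k)) \<and>
        (\<forall>i<r. fst (ps ! k) < i \<longrightarrow> D $$ (i, k) = 0))"

lemma pivotedD:
  assumes "pivoted V r ps D"
  shows "D \<in> carrier_mat r (length ps)" "distinct ps" "sorted (map fst ps)"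
    and "k < length ps \<Longrightarrow> fst (ps ! k) < r" "k < length ps \<Longrightarrow> snd (ps ! k) \<in> V"
    and "k < length ps \<Longrightarrow> i < r \<Longrightarrow> D $$ (i, k) \<in> carrier (poly_ring V)"
    and "k < length ps \<Longrightarrow> i < r \<Longrightarrow> homogeneous 1 (D $$ (i, k))"
    and "k < length ps \<Longrightarrow> D $$ (fst (ps ! k), k) = indet (snd (ps ! k))"
    and "k < length ps \<Longrightarrow> i < r \<Longrightarrow> fst (ps ! k) < i \<Longrightarrow> D $$ (i, k) = 0"
    and "k < k' \<Longrightarrow> k' < length ps \<Longrightarrow> fst (ps ! k) \<le> fst (ps ! k')"
    and "k < length ps \<Longrightarrow> k' < length ps \<Longrightarrow> k \<noteq> k' \<Longrightarrow> fst (ps ! k) = fst (ps ! k') \<Longrightarrow>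
      snd (ps ! k) \<noteq> snd (ps ! k')"
proof -
  show "k < length ps \<Longrightarrow> fst (ps ! k) < r" "k < length ps \<Longrightarrow> snd (ps ! k) \<in> V"
    using assms unfolding pivoted_def by (metis (mono_tags, lifting) case_prod_unfold nth_mem)+
  show "k < k' \<Longrightarrow> k' < length ps \<Longrightarrow> fst (ps ! k) \<le> fst (ps ! k')"
    using assms sorted_nth_mono[of "map fst ps" k k'] by (simp add: pivoted_def)
  show "k < length ps \<Longrightarrow> k' < length ps \<Longrightarrow> k \<noteq> k' \<Longrightarrow> fst (ps ! k) = fst (ps ! k') \<Longrightarrow>
      snd (ps ! k) \<noteq> snd (ps ! k')"
    using assms unfolding pivoted_def by (metis nth_eq_iff_index_eq prod_eqI)
qed (use assms in \<open>auto simp: pivoted_def\<close>)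

text \<open>All monomials of the last nonzero entry are constrained, not just one leading monomial:
  the whole entry lies in the ideal generated by the variables that \<open>P\<close> attaches to its
  position.\<close>

definition leads_at ::
    "('v, 'k::field) mpoly Matrix.vec set \<Rightarrow> nat \<Rightarrow> (nat \<times> 'v) set \<Rightarrow> bool" where
  "leads_at M r P \<longleftrightarrow>
     (\<forall>u\<in>M. \<forall>j<r. (\<forall>i<r. j < i \<longrightarrow> u $ i = 0) \<longrightarrow>
        (\<forall>m\<in>Poly_Mapping.keys (u $ j). \<exists>w. (j, w) \<in> P \<and> w \<in> Poly_Mapping.keys m))"

text \<open>Division by the columns, by induction on a bound \<open>J\<close> for the nonzero
  positions of \<open>u\<close>. The bound on the pivots used will keep a corrected syzygy from
  losing its own pivot, and the clause on degrees will make the next matrix linear.\<close>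

lemma pivoted_reduction:
  fixes D :: "('v, 'k::field) mpoly Matrix.mat"
  assumes D: "pivoted V r ps D"
    and M: "M \<subseteq> free_mod V r" "leads_at M r (set ps)"
    and closed: "\<And>u v. u \<in> M \<Longrightarrow> v \<in> free_mod V (length ps) \<Longrightarrow> u - D *\<^sub>v v \<in> M"
    and "u \<in> M" "J \<le> r" "\<And>i. i < r \<Longrightarrow> J \<le> i \<Longrightarrow> u $ i = 0"
  shows "\<exists>v\<in>free_mod V (length ps). D *\<^sub>v v = u \<and>
    (\<forall>k<length ps. J \<le> fst (ps ! k) \<longrightarrow> v $ k = 0) \<and>
    (\<forall>e. (\<forall>i<r. homogeneous (e + 1) (u $ i)) \<longrightarrow> (\<forall>k<length ps. homogeneous e (v $ k)))"
  using assms(5-)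
proof (induction J arbitrary: u)
  case 0
  then have "u \<in> carrier_vec r" using M free_mod_carrier by blast
  with 0 have "u = 0\<^sub>v r" by (intro eq_vecI) auto
  moreover have "D *\<^sub>v 0\<^sub>v (length ps) = 0\<^sub>v r"
    using pivotedD(1)[OF D] by (auto simp: index_mult_mat_vec_sum simp del: index_mult_mat_vec)
  ultimately show ?case
    by (intro bexI[of _ "0\<^sub>v (length ps)"]) (auto simp: free_mod_zero)
next
  case (Suc J)
  let ?s = "length ps"
  let ?K = "{k. k < ?s \<and> fst (ps ! k) = J}"
  let ?t = "\<lambda>k. Poly_Mapping.single (snd (ps ! k)) 1 :: 'v \<Rightarrow>\<^sub>0 nat"
  have uR: "u \<in> free_mod V r" using Suc.prems M by blast
  have J: "J < r" using Suc.prems by simp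
  have "\<exists>k\<in>?K. \<exists>m'. m = ?t k + m'" if m: "m \<in> Poly_Mapping.keys (u $ J)" for m
  proof -
    obtain w where "(J, w) \<in> set ps" "w \<in> Poly_Mapping.keys m"
      using M(2) Suc.prems m J unfolding leads_at_def by (meson Suc_leI)
    then obtain k where k: "k < ?s" "ps ! k = (J, w)" by (metis in_set_conv_nth)
    moreover obtain m' where "m = face_mon {w} + m'"
      
      using face_mon_dvd[of "{w}" m] \<open>w \<in> _\<close> by auto
    ultimately show ?thesis by (auto simp: face_mon_singleton intro!: exI[of _ k])
  qed
  then obtain q where q: "u $ J = (\<Sum>k\<in>?K. Poly_Mapping.single (?t k) 1 * q k)"
    "\<And>k m. m \<in> Poly_Mapping.keys (q k) \<Longrightarrow> ?t k + m \<in> Poly_Mapping.keys (u $ J)"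
    by (rule divide_by_monomials[rotated]) auto
  have qR: "q k \<in> carrier (poly_ring V)" for k
    unfolding poly_ring_iff
  proof
    fix m assume "m \<in> Poly_Mapping.keys (q k)"
    then have "Poly_Mapping.keys (?t k + m) \<subseteq> V"
      using free_mod_index[OF uR J] q(2) by (simp add: poly_ring_iff)
    then show "Poly_Mapping.keys m \<subseteq> V" by (simp add: keys_add_nat)
  qed
  have qhom: "homogeneous e (q k)" if "homogeneous (e + 1) (u $ J)" for e k
    unfolding homogeneous_def
  proof
    fix m assume "m \<in> Poly_Mapping.keys (q k)"
    then have "int (mon_degree (?t k + m)) = e + 1"
      using that q(2) by (simp add: homogeneous_def)
    moreover have "mon_degree (?t k) = 1" by (rule mon_degree_single)
    ultimately show "int (mon_degree m) = e" by (simp only: mon_degree_add)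
  qed
  \<comment> \<open>Only columns with pivot in row \<open>J\<close> are used. They vanish in all
    later rows, so subtracting them kills the entry at \<open>J\<close> and keeps the zeros after
    it.\<close>
  define v where "v = vec ?s (\<lambda>k. if fst (ps ! k) = J then q k else 0)"
  have v: "v \<in> free_mod V ?s" using qR by (auto simp: v_def free_mod_def)
  note DD = pivotedD[OF D]
  have Dv: "D *\<^sub>v v \<in> free_mod V r"
    using DD v by (intro free_mod_mult_mat_vec) auto
  have Dvi: "(D *\<^sub>v v) $ i = (\<Sum>k\<in>?K. D $$ (i, k) * q k)" if "i < r" for i
  proof -
    have "(D *\<^sub>v v) $ i = (\<Sum>k<?s. D $$ (i, k) * v $ k)"
      using DD(1) v that by (intro index_mult_mat_vec_sum) (auto simp: free_mod_def)
    also have "\<dots> = (\<Sum>k\<in>?K. D $$ (i, k) * q k)"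
      by (rule sum.mono_neutral_cong_right) (auto simp: v_def)
    finally show ?thesis .
  qed
  have "(u - D *\<^sub>v v) $ i = 0" if i: "i < r" "J \<le> i" for i
  proof (cases "i = J")
    case True
    have "(D *\<^sub>v v) $ J = u $ J"
      unfolding q(1) Dvi[OF J] using DD(8) by (intro sum.cong) (auto simp: indet_def)
    then show ?thesis using True J DD(1) by simp
  next
    case False
    then have "(D *\<^sub>v v) $ i = 0"
      unfolding Dvi[OF i(1)] using DD(9) i by (intro sum.neutral) auto
    then show ?thesis using False Suc.prems i DD(1) by simp
  qed
  then obtain v' where v': "v' \<in> free_mod V ?s" "D *\<^sub>v v' = u - D *\<^sub>v v"
    "\<forall>k<?s. J \<le> fst (ps ! k) \<longrightarrow> v' $ k = 0"
    "\<forall>e. (\<forall>i<r. homogeneous (e + 1) ((u - D *\<^sub>v v) $ i)) \<longrightarrow> (\<forall>k<?s. homogeneous e (v' $ k))"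
    using Suc.IH[of "u - D *\<^sub>v v"] closed[OF Suc.prems(1) v] J by auto
  have "D *\<^sub>v (v + v') = D *\<^sub>v v + D *\<^sub>v v'"
    using DD(1) v v'(1) by (intro mult_add_distrib_mat_vec) (auto simp: free_mod_def)
  also have "\<dots> = u" unfolding v'(2)
    using free_mod_carrier[OF uR] DD(1) by (intro eq_vecI) (auto simp del: index_mult_mat_vec)
  finally have eq: "D *\<^sub>v (v + v') = u" .
  have dim: "dim_vec v' = ?s" "dim_vec v = ?s" using v v'(1) by (auto simp: free_mod_def)
  show ?case
  proof (intro bexI[of _ "v + v'"] conjI allI impI)
    show "D *\<^sub>v (v + v') = u" by (rule eq)
    show "(v + v') $ k = 0" if "k < ?s" "Suc J \<le> fst (ps ! k)" for k
      using that v'(3) dim by (simp add: v_def)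
    show "homogeneous e ((v + v') $ k)"
      if e: "\<forall>i<r. homogeneous (e + 1) (u $ i)" and k: "k < ?s" for e k
    proof -
      have vhom: "homogeneous e (v $ k)" if "k < ?s" for k
        using that qhom[of e] e J by (simp add: v_def)
      have "homogeneous (e + 1) ((D *\<^sub>v v) $ i)" if "i < r" for i
        unfolding Dvi[OF that] using DD(7) qhom[of e] e J that
        by (intro homogeneous_sum) (metis (mono_tags, lifting) add.commute homogeneous_mult mem_Collect_eq)
      then have "\<forall>i<r. homogeneous (e + 1) ((u - D *\<^sub>v v) $ i)"
        using e DD(1) by (simp add: homogeneous_diff del: index_mult_mat_vec)
      then show ?thesis
        using v'(4) vhom k dim by (auto intro!: homogeneous_add)
    qed
    show "v + v' \<in> free_mod V ?s" using v v'(1) by (rule free_mod_add)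
  qed
qed

text \<open>Sorting by position ensures that a column before column \<open>k\<close> has its pivot
  in the same row or an earlier one. Within a row any order will do.\<close>

lemma lex_enumeration:
  fixes W :: "nat \<Rightarrow> 'v set"
  assumes "\<And>j. j < r \<Longrightarrow> finite (W j)"
  shows "\<exists>ps. set ps = {(j, w). j < r \<and> w \<in> W j} \<and> distinct ps \<and> sorted (map fst ps)"
  using assms
proof (induction r)
  case (Suc r)
  have "\<exists>ps. set ps = {(j, w). j < r \<and> w \<in> W j} \<and> distinct ps \<and> sorted (map fst ps)"
    by (rule Suc.IH) (simp add: Suc.prems)
  then obtain ps where ps: "set ps = {(j, w). j < r \<and> w \<in> W j}" "distinct ps" "sorted (map fst ps)"
    by blast
  obtain ws where ws: "set ws = W r" "distinct ws"
    using Suc.prems[of r] finite_distinct_list by blast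
  let ?qs = "ps @ map (Pair r) ws"
  have "set ?qs = {(j, w). j < Suc r \<and> w \<in> W j}"
    using ps ws by (auto simp: less_Suc_eq)
  moreover have "distinct ?qs"
    using ps ws by (auto simp: distinct_map inj_on_def)
  moreover have "sorted (map fst ?qs)"
    using ps by (auto simp: sorted_append map_replicate_const o_def)
  ultimately show ?case by blast
qed auto

definition vec_kernel :: "'v set \<Rightarrow> nat \<Rightarrow> nat \<Rightarrow> ('v, 'k::field) mpoly Matrix.mat \<Rightarrow> ('v, 'k) mpoly Matrix.vec set" where
  "vec_kernel V q r B = {u \<in> free_mod V r. B *\<^sub>v u = 0\<^sub>v q}"

text \<open>If every prescribed leading pair is realised by a linear kernel vector and every kernel
  vector is led by some pair, then division by the chosen vectors leaves no remainder, so they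
  generate the kernel. \<open>B\<close> is the row of generators at the start and the preceding
  matrix later.\<close>

lemma pivoted_cover:
  fixes B :: "('v, 'k::field) mpoly Matrix.mat"
  assumes B: "B \<in> carrier_mat q r" and V: "finite V" and W: "\<And>j. j < r \<Longrightarrow> W j \<subseteq> V"
    and lead: "leads_at (vec_kernel V q r B) r {(j, w). j < r \<and> w \<in> W j}"
    and cols: "\<And>j w. j < r \<Longrightarrow> w \<in> W j \<Longrightarrow> \<exists>c\<in>vec_kernel V q r B.
      (\<forall>i<r. homogeneous 1 (c $ i)) \<and> c $ j = indet w \<and> (\<forall>i<r. j < i \<longrightarrow> c $ i = 0)"
  obtains ps D where "pivoted V r ps D" "(\<lambda>v. D *\<^sub>v v) ` free_mod V (length ps) = vec_kernel V q r B"
    "leads_at (vec_kernel V q r B) r (set ps)"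
proof -
  obtain ps where ps: "set ps = {(j, w). j < r \<and> w \<in> W j}" "distinct ps" "sorted (map fst ps)"
    using lex_enumeration[of r W] finite_subset[OF W V] by blast
  define c where "c x = (SOME c. c \<in> vec_kernel V q r B \<and> (\<forall>i<r. homogeneous 1 (c $ i)) \<and>
      c $ fst x = indet (snd x) \<and> (\<forall>i<r. fst x < i \<longrightarrow> c $ i = 0))" for x
  have c: "c (j, w) \<in> vec_kernel V q r B \<and> (\<forall>i<r. homogeneous 1 (c (j, w) $ i)) \<and>
      c (j, w) $ j = indet w \<and> (\<forall>i<r. j < i \<longrightarrow> c (j, w) $ i = 0)" if "j < r" "w \<in> W j" for j w
    using someI_ex[OF cols[OF that, unfolded Bex_def]] by (simp add: c_def)
  have c': "fst (ps ! k) < r" "snd (ps ! k) \<in> V"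
    "c (ps ! k) \<in> vec_kernel V q r B" "c (ps ! k) $ fst (ps ! k) = indet (snd (ps ! k))"
    "i < r \<Longrightarrow> homogeneous 1 (c (ps ! k) $ i)"
    "i < r \<Longrightarrow> fst (ps ! k) < i \<Longrightarrow> c (ps ! k) $ i = 0" if "k < length ps" for k i
  proof -
    obtain j w where jw: "ps ! k = (j, w)" by fastforce
    then have "j < r" "w \<in> W j" using ps(1) nth_mem[OF that] by auto
    then show "fst (ps ! k) < r" "snd (ps ! k) \<in> V"
      "c (ps ! k) \<in> vec_kernel V q r B" "c (ps ! k) $ fst (ps ! k) = indet (snd (ps ! k))"
      "i < r \<Longrightarrow> homogeneous 1 (c (ps ! k) $ i)"
      "i < r \<Longrightarrow> fst (ps ! k) < i \<Longrightarrow> c (ps ! k) $ i = 0"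
      using c[of j w] jw W by auto
  qed
  define D where "D = mat r (length ps) (\<lambda>(i, k). c (ps ! k) $ i)"
  have D: "D \<in> carrier_mat r (length ps)" by (simp add: D_def)
  have cR: "c (ps ! k) $ i \<in> carrier (poly_ring V)" if "k < length ps" "i < r" for k i
    using c'(3)[OF that(1)] that(2) by (auto simp: vec_kernel_def free_mod_def)
  have piv: "pivoted V r ps D"
    unfolding pivoted_def
  proof (intro conjI)
    show "\<forall>(j, w)\<in>set ps. j < r \<and> w \<in> V" unfolding ps(1) using W by blast
  qed (use D ps c' cR in \<open>auto simp: D_def\<close>)
  have BD: "B * D = 0\<^sub>m q (length ps)"
  proof (rule eq_matI)
    fix i k assume "i < dim_row (0\<^sub>m q (length ps) :: ('v, 'k) mpoly Matrix.mat)"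
      "k < dim_col (0\<^sub>m q (length ps) :: ('v, 'k) mpoly Matrix.mat)"
    then have ik: "i < q" "k < length ps" by auto
    have "col D k = c (ps ! k)"
      using ik c'(3)[OF ik(2)] by (auto simp: D_def vec_kernel_def free_mod_def)
    then have "(B * D) $$ (i, k) = (B *\<^sub>v c (ps ! k)) $ i"
      using ik B D by simp
    also have "\<dots> = 0" using c'(3)[OF ik(2)] ik by (simp add: vec_kernel_def)
    finally show "(B * D) $$ (i, k) = 0\<^sub>m q (length ps) $$ (i, k)" using ik by simp
  qed (use B D in auto)
  have ker: "D *\<^sub>v v \<in> vec_kernel V q r B" if v: "v \<in> free_mod V (length ps)" for v
  proof -
    have vc: "v \<in> carrier_vec (length ps)" using v by (simp add: free_mod_def)
    have "B *\<^sub>v (D *\<^sub>v v) = (B * D) *\<^sub>v v"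
      using B D vc by (rule assoc_mult_mat_vec[symmetric])
    also have "\<dots> = 0\<^sub>v q" unfolding BD using vc by auto
    finally show ?thesis
      using free_mod_mult_mat_vec[OF D _ v] cR by (auto simp: vec_kernel_def D_def)
  qed
  have closed: "u - D *\<^sub>v v \<in> vec_kernel V q r B"
    if u: "u \<in> vec_kernel V q r B" and v: "v \<in> free_mod V (length ps)" for u v
  proof -
    note k = ker[OF v]
    have "B *\<^sub>v (u - D *\<^sub>v v) = B *\<^sub>v u - B *\<^sub>v (D *\<^sub>v v)"
      using B u k by (intro mult_minus_distrib_mat_vec) (auto simp: vec_kernel_def free_mod_def)
    then show ?thesis
      using u k by (auto simp: vec_kernel_def intro: free_mod_diff)
  qed
  have lead': "leads_at (vec_kernel V q r B) r (set ps)" using lead ps(1) by simp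
  have "vec_kernel V q r B \<subseteq> (\<lambda>v. D *\<^sub>v v) ` free_mod V (length ps)"
  proof
    fix u assume u: "u \<in> vec_kernel V q r B"
    have "\<exists>v\<in>free_mod V (length ps). D *\<^sub>v v = u \<and>
      (\<forall>k<length ps. r \<le> fst (ps ! k) \<longrightarrow> v $ k = 0) \<and>
      (\<forall>e. (\<forall>i<r. homogeneous (e + 1) (u $ i)) \<longrightarrow> (\<forall>k<length ps. homogeneous e (v $ k)))"
      by (rule pivoted_reduction[OF piv _ lead' closed u]) (auto simp: vec_kernel_def)
    then show "u \<in> (\<lambda>v. D *\<^sub>v v) ` free_mod V (length ps)" by blast
  qed
  then show ?thesis using ker by (intro that[OF piv _ lead']) auto
qed

section \<open>Iterated linear syzygies\<close>

text \<open>The invariant of the iteration: the columns are a Groebner basis of their own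
  image.\<close>

definition linear_stage :: "'v set \<Rightarrow> nat \<Rightarrow> (nat \<times> 'v) list \<Rightarrow> ('v, 'k::field) mpoly Matrix.mat \<Rightarrow> bool" where
  "linear_stage V r ps D \<longleftrightarrow> pivoted V r ps D \<and>
     leads_at ((\<lambda>v. D *\<^sub>v v) ` free_mod V (length ps)) r (set ps)"

text \<open>On monomials this is the equality of ideals (x_w) : x_v = (x_w).\<close>

lemma keys_indet_mult:
  fixes p :: "('v, 'k::field) mpoly"
  assumes "Poly_Mapping.single v 1 + m \<in> Poly_Mapping.keys (indet w * p)" "v \<noteq> w"
  shows "w \<in> Poly_Mapping.keys m"
proof -
  obtain m' where "Poly_Mapping.single v 1 + m = Poly_Mapping.single w 1 + m'"
    using assms(1) unfolding indet_def by (rule keys_single_mult)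
  then have "Poly_Mapping.keys (Poly_Mapping.single v 1 + m) =
      Poly_Mapping.keys (Poly_Mapping.single w (1::nat) + m')" by simp
  then show ?thesis using assms(2) by (auto simp: keys_add_nat)
qed

text \<open>By comparing entries in the pivot row of column \<open>k\<close>, the last coefficient of a syzygy is seen
  to lie in a colon ideal of variables \<open>(x\<^sub>1, \<dots>, x\<^sub>l) : x\<^bsub>l+1\<^esub> = (x\<^sub>1, \<dots>, x\<^sub>l)\<close>.\<close>

lemma linear_stage_step:
  fixes D :: "('v, 'k::field) mpoly Matrix.mat"
  assumes V: "finite V" and st: "linear_stage V r ps D"
  obtains ps' D' where "linear_stage V (length ps) ps' D'"
    "(\<lambda>v. D' *\<^sub>v v) ` free_mod V (length ps') = vec_kernel V r (length ps) D"
proof -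
  let ?s = "length ps"
  have piv: "pivoted V r ps D" and lead: "leads_at ((\<lambda>v. D *\<^sub>v v) ` free_mod V ?s) r (set ps)"
    using st by (auto simp: linear_stage_def)
  note DD = pivotedD[OF piv]
  \<comment> \<open>The pivots of the next stage in position \<open>k\<close>: the pivot variables
    of the earlier columns with the same pivot row. They generate the colon ideal that belongs to
    column \<open>k\<close>.\<close>
  define W where "W k = {snd (ps ! k') | k'. k' < k \<and> fst (ps ! k') = fst (ps ! k)}" for k
  have W: "W k \<subseteq> V" if "k < ?s" for k
    using that DD(5) by (auto simp: W_def)
  have im: "D *\<^sub>v v \<in> free_mod V r" if "v \<in> free_mod V ?s" for v
    using DD that by (intro free_mod_mult_mat_vec) auto
  have lead': "leads_at (vec_kernel V r ?s D) ?s {(k, w). k < ?s \<and> w \<in> W k}"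
    unfolding leads_at_def
  proof (intro ballI allI impI)
    fix u k m
    assume u: "u \<in> vec_kernel V r ?s D" and k: "k < ?s" "\<forall>i<?s. k < i \<longrightarrow> u $ i = 0"
      and m: "m \<in> Poly_Mapping.keys (u $ k)"
    let ?j = "fst (ps ! k)" and ?w = "snd (ps ! k)"
    have j: "?j < r" using DD(4) k by simp
    have "0 = (D *\<^sub>v u) $ ?j" using u j by (simp add: vec_kernel_def)
    also have "\<dots> = (\<Sum>k'<?s. D $$ (?j, k') * u $ k')"
      using DD(1) u j by (intro index_mult_mat_vec_sum) (auto simp: vec_kernel_def free_mod_def)
    \<comment> \<open>Columns after \<open>k\<close> have coefficient 0, and earlier columns whose
      pivot lies before row \<open>?j\<close> have entry 0 there. In row \<open>?j\<close> only
      pivots remain.\<close>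
    also have "\<dots> = (\<Sum>k'\<in>insert k {k'. k' < k \<and> fst (ps ! k') = ?j}. D $$ (?j, k') * u $ k')"
    proof (intro sum.mono_neutral_right ballI)
      fix k' assume k': "k' \<in> {..<?s} - insert k {k'. k' < k \<and> fst (ps ! k') = ?j}"
      show "D $$ (?j, k') * u $ k' = 0"
      proof (cases "k < k'")
        case True
        then show ?thesis using k k' by simp
      next
        case False
        then have "fst (ps ! k') < ?j" using k' DD(10)[of k' k] k by fastforce
        then show ?thesis using DD(9)[of k' ?j] k' j by simp
      qed
    qed (use k in auto)
    also have "\<dots> = indet ?w * u $ k + (\<Sum>k'\<in>{k'. k' < k \<and> fst (ps ! k') = ?j}. D $$ (?j, k') * u $ k')"
      using DD(8)[OF k(1)] by simp
    also have "(\<Sum>k'\<in>{k'. k' < k \<and> fst (ps ! k') = ?j}. D $$ (?j, k') * u $ k') =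
        (\<Sum>k'\<in>{k'. k' < k \<and> fst (ps ! k') = ?j}. indet (snd (ps ! k')) * u $ k')"
    proof (intro sum.cong refl)
      fix k' assume "k' \<in> {k'. k' < k \<and> fst (ps ! k') = ?j}"
      then show "D $$ (?j, k') * u $ k' = indet (snd (ps ! k')) * u $ k'"
        using DD(8)[of k'] k by simp
    qed
    finally have "indet ?w * u $ k =
        - (\<Sum>k'\<in>{k'. k' < k \<and> fst (ps ! k') = ?j}. indet (snd (ps ! k')) * u $ k')"
      by (simp add: eq_neg_iff_add_eq_0)
    moreover have "Poly_Mapping.single ?w 1 + m \<in> Poly_Mapping.keys (indet ?w * u $ k)"
      unfolding indet_def using m by (rule keys_single_mult_add)
    ultimately have "Poly_Mapping.single ?w 1 + m \<in> Poly_Mapping.keys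
        (\<Sum>k'\<in>{k'. k' < k \<and> fst (ps ! k') = ?j}. indet (snd (ps ! k')) * u $ k')"
      by (simp add: in_keys_iff)
    then obtain k' where k': "k' < k" "fst (ps ! k') = ?j"
      "Poly_Mapping.single ?w 1 + m \<in> Poly_Mapping.keys (indet (snd (ps ! k')) * u $ k')"
      by (rule keys_sum_mem) auto
    then have "snd (ps ! k') \<in> Poly_Mapping.keys m"
      using keys_indet_mult DD(11)[of k k'] k by (metis less_trans less_irrefl)
    then show "\<exists>w. (k, w) \<in> {(k, w). k < ?s \<and> w \<in> W k} \<and> w \<in> Poly_Mapping.keys m"
      using k k' by (auto simp: W_def)
  qed
  have cols: "\<exists>c\<in>vec_kernel V r ?s D. (\<forall>i<?s. homogeneous 1 (c $ i)) \<and> c $ k = indet w \<and>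
      (\<forall>i<?s. k < i \<longrightarrow> c $ i = 0)" if k: "k < ?s" and w: "w \<in> W k" for k w
  proof -
    obtain k' where k': "k' < k" "fst (ps ! k') = fst (ps ! k)" "w = snd (ps ! k')"
      using w by (auto simp: W_def)
    let ?j = "fst (ps ! k)" and ?v = "snd (ps ! k)"
    have j: "?j < r" using DD(4) k by simp
    have vV: "?v \<in> V" "w \<in> V" using DD(5) k k' by auto
    \<comment> \<open>The S-vector of the columns \<open>k\<close> and \<open>k'\<close>: their
      pivots cancel in row \<open>?j\<close>.\<close>
    define x :: "('v, 'k) mpoly Matrix.vec" where
      "x = vec ?s (\<lambda>i. if i = k then indet w else if i = k' then - indet ?v else 0)"
    have x: "x \<in> free_mod V ?s"
      using vV by (auto simp: x_def free_mod_def indet_in_poly_ring)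
    have Dx: "(D *\<^sub>v x) $ i = D $$ (i, k) * indet w - D $$ (i, k') * indet ?v" if "i < r" for i
    proof -
      have "(D *\<^sub>v x) $ i = (\<Sum>l<?s. D $$ (i, l) * x $ l)"
        using DD(1) x that by (intro index_mult_mat_vec_sum) (auto simp: free_mod_def)
      also have "\<dots> = (\<Sum>l\<in>{k, k'}. D $$ (i, l) * x $ l)"
        using k k' by (intro sum.mono_neutral_right) (auto simp: x_def)
      also have "\<dots> = D $$ (i, k) * indet w - D $$ (i, k') * indet ?v"
        using k k' by (simp add: x_def)
      finally show ?thesis .
    qed
    have zero: "(D *\<^sub>v x) $ i = 0" if i: "i < r" "?j \<le> i" for i
    proof (cases "i = ?j")
      case True
      then show ?thesis
        using Dx[OF i(1)] DD(8)[of k] DD(8)[of k'] k k' by (simp add: mult.commute)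
    next
      case False
      then show ?thesis
        using Dx[OF i(1)] DD(9)[of k i] DD(9)[of k' i] k k' i by simp
    qed
    have hom: "homogeneous (1 + 1) ((D *\<^sub>v x) $ i)" if "i < r" for i
      unfolding Dx[OF that] using DD(7)[of k i] DD(7)[of k' i] k k' that
      by (intro homogeneous_diff homogeneous_mult homogeneous_indet) auto
    \<comment> \<open>The image of \<open>x\<close> lives in rows before \<open>?j\<close>, so its
      reduction \<open>y\<close> uses only columns with pivots before \<open>?j\<close>. By
      sortedness these precede \<open>k\<close>, hence \<open>x - y\<close> keeps
      \<open>indet w\<close> as its last nonzero entry. The image has degree 2, so \<open>y\<close>
      is linear.\<close>
    have "\<exists>y\<in>free_mod V ?s. D *\<^sub>v y = D *\<^sub>v x \<and>
        (\<forall>k<?s. ?j \<le> fst (ps ! k) \<longrightarrow> y $ k = 0) \<and>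
        (\<forall>e. (\<forall>i<r. homogeneous (e + 1) ((D *\<^sub>v x) $ i)) \<longrightarrow> (\<forall>k<?s. homogeneous e (y $ k)))"
    proof (rule pivoted_reduction[OF piv _ lead])
      fix u v :: "('v, 'k) mpoly Matrix.vec"
      assume "u \<in> (\<lambda>v. D *\<^sub>v v) ` free_mod V ?s" and v: "v \<in> free_mod V ?s"
      then obtain u' where u': "u' \<in> free_mod V ?s" "u = D *\<^sub>v u'" by blast
      then have "D *\<^sub>v (u' - v) = u - D *\<^sub>v v"
        using v DD(1) by (auto intro!: mult_minus_distrib_mat_vec simp: free_mod_def)
      then show "u - D *\<^sub>v v \<in> (\<lambda>v. D *\<^sub>v v) ` free_mod V ?s"
        using free_mod_diff[OF u'(1) v] by (metis imageI)
    qed (use x im zero j in auto)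
    then obtain y where y: "y \<in> free_mod V ?s" "D *\<^sub>v y = D *\<^sub>v x"
      "\<And>k. k < ?s \<Longrightarrow> ?j \<le> fst (ps ! k) \<Longrightarrow> y $ k = 0" "\<And>k. k < ?s \<Longrightarrow> homogeneous 1 (y $ k)"
      using hom by blast
    have dim: "dim_vec x = ?s" "dim_vec y = ?s" using x y(1) by (auto simp: free_mod_def)
    have "D *\<^sub>v (x - y) = D *\<^sub>v x - D *\<^sub>v y"
      using DD(1) x y(1) by (intro mult_minus_distrib_mat_vec) (auto simp: free_mod_def)
    also have "\<dots> = 0\<^sub>v r" using y(2) DD(1) by auto
    finally have ker: "x - y \<in> vec_kernel V r ?s D"
      using free_mod_diff[OF x y(1)] by (simp add: vec_kernel_def)
    show ?thesis
    proof (intro bexI[OF _ ker] conjI allI impI)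
      show "homogeneous 1 ((x - y) $ i)" if "i < ?s" for i
      proof -
        have "homogeneous 1 (x $ i)" using that by (simp add: x_def homogeneous_indet)
        then show ?thesis using y(4)[OF that] that dim by (auto intro: homogeneous_diff)
      qed
      show "(x - y) $ k = indet w" using k y(3)[of k] dim by (simp add: x_def)
      show "(x - y) $ i = 0" if "i < ?s" "k < i" for i
        using that y(3)[of i] DD(10)[of k i] k' dim by (simp add: x_def)
    qed
  qed
  obtain ps' D' where "pivoted V ?s ps' D'"
    "(\<lambda>v. D' *\<^sub>v v) ` free_mod V (length ps') = vec_kernel V r ?s D"
    "leads_at (vec_kernel V r ?s D) ?s (set ps')"
    by (rule pivoted_cover[OF DD(1) V W lead' cols])
  then show ?thesis using that by (simp add: linear_stage_def)
qed

lemma linear_stage_sequence: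
  fixes D :: "('v, 'k::field) mpoly Matrix.mat"
  assumes V: "finite V" and st: "linear_stage V r ps D"
  shows "\<exists>b DS PS. b 0 = r \<and> DS 0 = D \<and> PS 0 = ps \<and>
    (\<forall>i::nat. linear_stage V (b i) (PS i) (DS i) \<and> b (Suc i) = length (PS i) \<and>
      (\<lambda>v. DS (Suc i) *\<^sub>v v) ` free_mod V (b (Suc (Suc i))) = vec_kernel V (b i) (b (Suc i)) (DS i))"
proof -
  \<comment> \<open>The clause for \<open>n = 0\<close> pins the start of the sequence to the given
    stage; dependent choice by itself only yields some start satisfying \<open>P 0\<close>.\<close>
  define P where "P n x \<longleftrightarrow> (case x of (r', ps', D') \<Rightarrow> linear_stage V r' ps' D' \<and>
    (n = 0 \<longrightarrow> r' = r \<and> ps' = ps \<and> D' = D))" for n :: nat and x :: "nat \<times> (nat \<times> 'v) list \<times> ('v, 'k) mpoly Matrix.mat"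
  define Q where "Q x y \<longleftrightarrow> (case x of (r', ps', D') \<Rightarrow> case y of (r'', ps'', D'') \<Rightarrow>
     r'' = length ps' \<and> (\<lambda>v. D'' *\<^sub>v v) ` free_mod V (length ps'') = vec_kernel V r' (length ps') D')"
    for x y :: "nat \<times> (nat \<times> 'v) list \<times> ('v, 'k) mpoly Matrix.mat"
  have "\<exists>f. \<forall>n. P n (f n) \<and> Q (f n) (f (Suc n))"
  proof (rule dependent_nat_choice)
    show "\<exists>x. P 0 x" using st by (auto simp: P_def)
    fix x n assume "P n x"
    then obtain r' ps' D' where x: "x = (r', ps', D')" "linear_stage V r' ps' D'"
      by (auto simp: P_def)
    obtain ps'' D'' where "linear_stage V (length ps') ps'' D''"
      "(\<lambda>v. D'' *\<^sub>v v) ` free_mod V (length ps'') = vec_kernel V r' (length ps') D'"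
      by (rule linear_stage_step[OF V x(2)])
    then show "\<exists>y. P (Suc n) y \<and> Q x y" using x
      by (intro exI[of _ "(length ps', ps'', D'')"]) (auto simp: P_def Q_def)
  qed
  then obtain f where f: "\<And>n. P n (f n)" "\<And>n. Q (f n) (f (Suc n))" by blast
  define b DS PS where "b n = fst (f n)" and "DS n = snd (snd (f n))" and "PS n = fst (snd (f n))" for n
  have f_eq: "f n = (b n, PS n, DS n)" for n by (simp add: b_def DS_def PS_def)
  have len: "b (Suc i) = length (PS i)" for i using f(2)[of i] by (simp add: Q_def f_eq)
  show ?thesis
  proof (intro exI[of _ b] exI[of _ DS] exI[of _ PS] conjI allI)
    show "b 0 = r" "DS 0 = D" "PS 0 = ps" using f(1)[of 0] by (simp_all add: P_def f_eq)
    show "linear_stage V (b i) (PS i) (DS i)" for i using f(1)[of i] by (simp add: P_def f_eq)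
    show "b (Suc i) = length (PS i)" for i by (rule len)
    show "(\<lambda>v. DS (Suc i) *\<^sub>v v) ` free_mod V (b (Suc (Suc i))) = vec_kernel V (b i) (b (Suc i)) (DS i)" for i
      using f(2)[of i] by (simp add: Q_def f_eq len)
  qed
qed

text \<open>The degrees \<open>d + int i\<close> fit because every matrix consists of linear forms.
  The resolution is minimal because a form of degree 1 has no constant term.\<close>

lemma has_linear_resolutionI:
  fixes g :: "('v, 'k::field) mpoly Matrix.vec"
  assumes V: "finite V" and g: "g \<in> free_mod V r" "\<And>j. j < r \<Longrightarrow> homogeneous d (g $ j)"
    and I: "(\<lambda>u. g \<bullet> u) ` free_mod V r = I"
    and st: "linear_stage V r ps D"
    and D: "(\<lambda>v. D *\<^sub>v v) ` free_mod V (length ps) = {u \<in> free_mod V r. g \<bullet> u = 0}"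
  shows "has_linear_resolution V I"
proof -
  obtain b DS PS where b: "b 0 = r" "DS 0 = D" "PS 0 = ps" "\<And>i::nat. linear_stage V (b i) (PS i) (DS i)"
    "\<And>i. b (Suc i) = length (PS i)"
    "\<And>i. (\<lambda>v. DS (Suc i) *\<^sub>v v) ` free_mod V (b (Suc (Suc i))) = vec_kernel V (b i) (b (Suc i)) (DS i)"
    using linear_stage_sequence[OF V st] by metis
  have piv: "pivoted V (b i) (PS i) (DS i)" for i using b(4) by (simp add: linear_stage_def)
  note DD = pivotedD[OF piv, folded b(5)]
  have "minimal_graded_free_resolution V I b (\<lambda>i j. d + int i) g DS"
    unfolding minimal_graded_free_resolution_def graded_free_resolution_def
  proof (intro conjI allI impI)
    show "DS i $$ (j, k) \<in> carrier (poly_ring V)" if "j < b i" "k < b (Suc i)" for i j k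
      using DD(6) that by blast
    show "homogeneous (d + int (Suc i) - (d + int i)) (DS i $$ (j, k))"
      if "j < b i" "k < b (Suc i)" for i j k
      using DD(7) that by simp
    show "Poly_Mapping.lookup (DS i $$ (j, k)) 0 = 0" if "j < b i" "k < b (Suc i)" for i j k
    proof -
      have "0 \<notin> Poly_Mapping.keys (DS i $$ (j, k))"
        using DD(7)[of k i j] that by (auto simp: homogeneous_def mon_degree_def)
      then show ?thesis by (simp add: in_keys_iff)
    qed
    show "(\<lambda>u. DS 0 *\<^sub>v u) ` free_mod V (b 1) = {u \<in> free_mod V (b 0). g \<bullet> u = 0}"
      using D b(1-3) b(5)[of 0] by simp
    show "(\<lambda>u. DS (Suc i) *\<^sub>v u) ` free_mod V (b (Suc (Suc i))) =
        {u \<in> free_mod V (b (Suc i)). DS i *\<^sub>v u = 0\<^sub>v (b i)}" for i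
      using b(6) by (simp add: vec_kernel_def)
  qed (use b g I DD(1) in auto)
  then show ?thesis unfolding has_linear_resolution_def by blast
qed

section \<open>Ideals with linear quotients\<close>

text \<open>The colon ideal of the monomials before \<open>fs ! i\<close> by that of
  \<open>fs ! i\<close> is generated by the monomials of the sets \<open>fs ! j - fs ! i\<close>. By
  \<open>quot\<close> each of them is a multiple of a variable \<open>w\<close> that is itself such
  a generator, so the first syzygies are led by variables.\<close>

lemma has_linear_resolution_linear_quotients:
  fixes fs :: "'v set list"
  assumes V: "simplicial_complex V \<Delta>" and fs: "set fs = facets \<Delta>"
    and n: "\<And>F. F \<in> facets \<Delta> \<Longrightarrow> card F = n"
    and quot: "\<And>i j. j < i \<Longrightarrow> i < length fs \<Longrightarrow>
      \<exists>l<i. \<exists>w\<in>fs ! j. fs ! l - fs ! i = {w}"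
  shows "has_linear_resolution V (facet_ideal V \<Delta> :: ('v, 'k::field) mpoly set)"
proof -
  let ?r = "length fs"
  have finV: "finite V" using V by (simp add: simplicial_complex_def)
  have fin: "finite F" and sub: "F \<subseteq> V" if "F \<in> facets \<Delta>" for F
    using that V finite_subset[of F V] by (auto simp: simplicial_complex_def facets_def)
  have fsF: "fs ! i \<in> facets \<Delta>" if "i < ?r" for i using that fs nth_mem by blast
  define g :: "('v, 'k) mpoly Matrix.vec" where "g = vec ?r (\<lambda>i. Poly_Mapping.single (face_mon (fs ! i)) 1)"
  \<comment> \<open>The augmentation as a matrix with one row, so that its kernel is a
    \<open>vec_kernel\<close> and \<open>pivoted_cover\<close> applies.\<close>
  define B where "B = mat 1 ?r (\<lambda>(_, i). g $ i)"
  have g: "g \<in> free_mod V ?r"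
    using fsF fin sub by (auto simp: g_def free_mod_def intro!: single_face_mon_in_poly_ring)
  have ghom: "homogeneous (int n) (g $ j)" if "j < ?r" for j
    using that fsF[OF that] n fin by (simp add: g_def homogeneous_def mon_degree_face_mon)
  have gu: "g \<bullet> u = (\<Sum>i<?r. Poly_Mapping.single (face_mon (fs ! i)) 1 * u $ i)" if "u \<in> free_mod V ?r" for u
    using that by (auto simp: scalar_prod_def g_def free_mod_def lessThan_atLeast0 intro!: sum.cong)
  have "row B 0 = g" by (auto simp: B_def g_def)
  then have "(B *\<^sub>v u) $ 0 = g \<bullet> u" "dim_vec (B *\<^sub>v u) = 1" for u
    by (simp_all add: B_def)
  then have Bu: "B *\<^sub>v u = 0\<^sub>v 1 \<longleftrightarrow> g \<bullet> u = 0" for u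
    by (auto simp: vec_eq_iff)
  have B: "B \<in> carrier_mat 1 ?r" by (simp add: B_def)
  have ker: "vec_kernel V 1 ?r B = {u \<in> free_mod V ?r. g \<bullet> u = 0}"
    unfolding vec_kernel_def Bu ..
  have "(\<lambda>u. g \<bullet> u) ` free_mod V ?r = facet_ideal V \<Delta>"
  proof (intro equalityI subsetI)
    fix p assume "p \<in> (\<lambda>u. g \<bullet> u) ` free_mod V ?r"
    then obtain u where u: "u \<in> free_mod V ?r" and p: "p = g \<bullet> u" by blast
    have "p \<in> carrier (poly_ring V)"
      unfolding p gu[OF u] using free_mod_index[OF u] fsF fin sub
      by (intro poly_ring_sum poly_ring_mult single_face_mon_in_poly_ring) auto
    moreover have "\<exists>F\<in>facets \<Delta>. F \<subseteq> Poly_Mapping.keys m" if m: "m \<in> Poly_Mapping.keys p" for m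
    proof -
      obtain i where i: "i < ?r" "m \<in> Poly_Mapping.keys (Poly_Mapping.single (face_mon (fs ! i)) 1 * u $ i)"
        using m unfolding p gu[OF u] by (auto elim: keys_sum_mem)
      then have "fs ! i \<subseteq> Poly_Mapping.keys m"
        using fin[OF fsF] by (auto elim!: keys_single_mult simp: keys_add_nat keys_face_mon)
      then show ?thesis using fsF i by blast
    qed
    ultimately show "p \<in> facet_ideal V \<Delta>" by (simp add: facet_ideal_iff[OF V])
  next
    fix p :: "('v, 'k) mpoly" assume p: "p \<in> facet_ideal V \<Delta>"
    have "\<exists>i\<in>{..<?r}. \<exists>m'. m = face_mon (fs ! i) + m'" if m: "m \<in> Poly_Mapping.keys p" for m
    proof -
      obtain F where "F \<in> facets \<Delta>" "F \<subseteq> Poly_Mapping.keys m"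
        using p m by (auto simp: facet_ideal_iff[OF V])
      moreover from this fs obtain i where "i < ?r" "F = fs ! i" by (metis in_set_conv_nth)
      ultimately show ?thesis using fin by (metis lessThan_iff face_mon_dvd)
    qed
    then obtain q where q: "p = (\<Sum>i\<in>{..<?r}. Poly_Mapping.single (face_mon (fs ! i)) 1 * q i)"
      "\<And>i m. m \<in> Poly_Mapping.keys (q i) \<Longrightarrow> face_mon (fs ! i) + m \<in> Poly_Mapping.keys p"
      by (rule divide_by_monomials[rotated]) auto
    have "q i \<in> carrier (poly_ring V)" for i
      unfolding poly_ring_iff
    proof
      fix m assume "m \<in> Poly_Mapping.keys (q i)"
      then have "Poly_Mapping.keys (face_mon (fs ! i) + m) \<subseteq> V"
        using p q(2) by (simp add: facet_ideal_iff[OF V] poly_ring_iff)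
      then show "Poly_Mapping.keys m \<subseteq> V" by (simp add: keys_add_nat)
    qed
    then have v: "vec ?r q \<in> free_mod V ?r" by (simp add: free_mod_def)
    have "g \<bullet> vec ?r q = p" unfolding gu[OF v] q(1) by simp
    then show "p \<in> (\<lambda>u. g \<bullet> u) ` free_mod V ?r" using v by blast
  qed
  note I = this
  define W where "W i = {w. \<exists>l<i. fs ! l - fs ! i = {w}}" for i
  have W: "W i \<subseteq> V" if "i < ?r" for i
  proof
    fix w assume "w \<in> W i"
    then obtain l where "l < i" "w \<in> fs ! l" by (auto simp: W_def)
    then show "w \<in> V" using that sub[OF fsF, of l] by auto
  qed
  have lead: "leads_at (vec_kernel V 1 ?r B) ?r {(j, w). j < ?r \<and> w \<in> W j}"
    unfolding leads_at_def ker
  proof (intro ballI allI impI)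
    fix u i m
    assume u: "u \<in> {u \<in> free_mod V ?r. g \<bullet> u = 0}" and i: "i < ?r" "\<forall>i'<?r. i < i' \<longrightarrow> u $ i' = 0"
      and m: "m \<in> Poly_Mapping.keys (u $ i)"
    let ?x = "\<lambda>j. Poly_Mapping.single (face_mon (fs ! j)) 1 * u $ j"
    have "0 = (\<Sum>j<?r. ?x j)" using u gu[of u] by simp
    also have "\<dots> = (\<Sum>j\<in>insert i {..<i}. ?x j)"
      using i by (intro sum.mono_neutral_right) auto
    also have "\<dots> = ?x i + (\<Sum>j<i. ?x j)" by simp
    finally have "?x i = - (\<Sum>j<i. ?x j)" by (simp add: eq_neg_iff_add_eq_0)
    moreover have "face_mon (fs ! i) + m \<in> Poly_Mapping.keys (?x i)"
      using m by (rule keys_single_mult_add)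
    ultimately have "face_mon (fs ! i) + m \<in> Poly_Mapping.keys (\<Sum>j<i. ?x j)"
      by (simp add: in_keys_iff)
    then obtain j where j: "j < i" "face_mon (fs ! i) + m \<in> Poly_Mapping.keys (?x j)"
      by (auto elim: keys_sum_mem)
    from j(2) obtain m' where "face_mon (fs ! i) + m = face_mon (fs ! j) + m'" by (rule keys_single_mult)
    then have "Poly_Mapping.keys (face_mon (fs ! i) + m) = Poly_Mapping.keys (face_mon (fs ! j) + m')" by simp
    \<comment> \<open>The monomial of \<open>fs ! j\<close> divides the product of \<open>m\<close>
      with that of \<open>fs ! i\<close>. The variable \<open>w\<close> from \<open>quot\<close>
      lies in \<open>fs ! j\<close> but not in \<open>fs ! i\<close>, so it occurs in
      \<open>m\<close>.\<close>
    then have "fs ! j \<subseteq> fs ! i \<union> Poly_Mapping.keys m"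
      using fin[OF fsF, of i] fin[OF fsF, of j] i j by (auto simp: keys_add_nat keys_face_mon)
    moreover obtain l w where "l < i" "w \<in> fs ! j" "fs ! l - fs ! i = {w}"
      using quot[OF j(1) i(1)] by blast
    ultimately show "\<exists>w. (i, w) \<in> {(j, w). j < ?r \<and> w \<in> W j} \<and> w \<in> Poly_Mapping.keys m"
      using i by (auto simp: W_def)
  qed
  have cols: "\<exists>c\<in>vec_kernel V 1 ?r B. (\<forall>i'<?r. homogeneous 1 (c $ i')) \<and> c $ i = indet w \<and>
      (\<forall>i'<?r. i < i' \<longrightarrow> c $ i' = 0)" if i: "i < ?r" and w: "w \<in> W i" for i w
  proof -
    obtain l where l: "l < i" "fs ! l - fs ! i = {w}" using w by (auto simp: W_def)
    let ?F = "fs ! i" and ?G = "fs ! l"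
    have F: "finite ?F" "finite ?G" "card ?F = n" "card ?G = n" "?F \<subseteq> V"
      using fsF[OF i] fsF[of l] i l fin n sub by auto
    \<comment> \<open>Equal sizes turn \<open>?G - ?F = {w}\<close> into an exchange of
      \<open>v\<close> for \<open>w\<close>. The relation x_w x_F = x_v x_G is the linear syzygy
      \<open>c\<close>.\<close>
    then have "card (?F - ?G) = card (?G - ?F)"
      by (metis card_le_sym_Diff order_antisym order_refl)
    then have "card (?F - ?G) = 1" using l by simp
    then obtain v where v: "?F - ?G = {v}" by (rule card_1_singletonE)
    have "insert w ?F = insert v ?G" using l v by blast
    moreover have "w \<notin> ?F" "v \<notin> ?G" using l v by auto
    ultimately have eq: "face_mon {w} + face_mon ?F = face_mon {v} + face_mon ?G"
      using F face_mon_Un_disjoint[of "{w}" ?F] face_mon_Un_disjoint[of "{v}" ?G] by simp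
    define c :: "('v, 'k) mpoly Matrix.vec" where
      "c = vec ?r (\<lambda>j. if j = i then indet w else if j = l then - indet v else 0)"
    have "w \<in> V" "v \<in> V" using W[OF i] w v F by auto
    then have c: "c \<in> free_mod V ?r" by (auto simp: c_def free_mod_def indet_in_poly_ring)
    have "g \<bullet> c = (\<Sum>j\<in>{i, l}. Poly_Mapping.single (face_mon (fs ! j)) 1 * c $ j)"
      unfolding gu[OF c] using i l by (intro sum.mono_neutral_right) (auto simp: c_def)
    also have "\<dots> = 0"
      using i l eq by (simp add: c_def indet_def mult_single face_mon_singleton add.commute)
    finally have "c \<in> vec_kernel V 1 ?r B" unfolding ker using c by simp
    then show ?thesis
      using i l by (intro bexI[of _ c]) (auto simp: c_def homogeneous_indet)
  qed
  obtain ps D where "pivoted V ?r ps D"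
    "(\<lambda>v. D *\<^sub>v v) ` free_mod V (length ps) = vec_kernel V 1 ?r B"
    "leads_at (vec_kernel V 1 ?r B) ?r (set ps)"
    by (rule pivoted_cover[OF B finV W lead cols])
  then show ?thesis
    using has_linear_resolutionI[OF finV g ghom I, of ps D] ker by (simp add: linear_stage_def)
qed

section \<open>Induced paths in leafy families\<close>

lemma successively_conv_nth:
  "successively P xs \<longleftrightarrow> (\<forall>i. Suc i < length xs \<longrightarrow> P (xs ! i) (xs ! Suc i))"
proof (induction xs rule: induct_list012)
  case (3 x y zs)
  have "(\<forall>i. Suc i < length (x # y # zs) \<longrightarrow> P ((x # y # zs) ! i) ((x # y # zs) ! Suc i)) \<longleftrightarrow>
      P x y \<and> (\<forall>i. Suc i < length (y # zs) \<longrightarrow> P ((y # zs) ! i) ((y # zs) ! Suc i))"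
    (is "(\<forall>i. ?A i) \<longleftrightarrow> ?B \<and> (\<forall>i. ?C i)")
  proof -
    have "?A 0 \<longleftrightarrow> ?B" "?A (Suc i) \<longleftrightarrow> ?C i" for i by simp_all
    then show ?thesis by (metis not0_implies_Suc)
  qed
  then show ?case using 3 by simp
qed simp_all

text \<open>Intersection in codimension one for sets of size \<open>n\<close>. With
  \<open>n - 1\<close> in place of \<open>Suc\<close>, truncated subtraction would make the empty
  set adjacent to itself for \<open>n = 0\<close>.\<close>

definition adj :: "nat \<Rightarrow> 'v set \<Rightarrow> 'v set \<Rightarrow> bool" where
  "adj n F G \<longleftrightarrow> Suc (card (F \<inter> G)) = n"

lemma adj_commute: "adj n F G \<longleftrightarrow> adj n G F"
  by (simp add: adj_def Int_commute)

text \<open>If a leaf of a pure complex has a neighbour \<open>H\<close>, then \<open>H\<close> can be taken as the facet \<open>G\<close> in the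
  definition of a leaf. Without neighbours the condition is void.\<close>

definition pure_leaf :: "nat \<Rightarrow> 'v set set \<Rightarrow> 'v set \<Rightarrow> bool" where
  "pure_leaf n T L \<longleftrightarrow> L \<in> T \<and> (\<forall>H\<in>T. adj n L H \<longrightarrow> (\<forall>K\<in>T. K \<noteq> L \<longrightarrow> L \<inter> K \<subseteq> H))"

lemma pure_leafD:
  "pure_leaf n T L \<Longrightarrow> H \<in> T \<Longrightarrow> adj n L H \<Longrightarrow> K \<in> T \<Longrightarrow> K \<noteq> L \<Longrightarrow> L \<inter> K \<subseteq> H"
  by (simp add: pure_leaf_def)

text \<open>The hereditary part of being a tree. Connectedness is left out because subfamilies lose
  it, while the inductions below remove one facet at a time.\<close>

definition leafy :: "nat \<Rightarrow> 'v set set \<Rightarrow> bool" where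
  "leafy n S \<longleftrightarrow> (\<forall>F\<in>S. finite F \<and> card F = n) \<and> (\<forall>T\<subseteq>S. T \<noteq> {} \<longrightarrow> (\<exists>L. pure_leaf n T L))"

lemma leafy_subset: "leafy n S \<Longrightarrow> T \<subseteq> S \<Longrightarrow> leafy n T"
  by (auto simp: leafy_def)

lemma leafy_card: "leafy n S \<Longrightarrow> F \<in> S \<Longrightarrow> finite F \<and> card F = n"
  by (auto simp: leafy_def)

lemma leafy_pure_leaf: "leafy n S \<Longrightarrow> T \<subseteq> S \<Longrightarrow> T \<noteq> {} \<Longrightarrow> \<exists>L. pure_leaf n T L"
  by (auto simp: leafy_def)

lemma not_adj_refl: "card F = n \<Longrightarrow> \<not> adj n F F"
  by (simp add: adj_def)

lemma adjI:
  assumes "finite F" "card F = n" "card G = n" "finite G" "F \<noteq> G" "A \<subseteq> F \<inter> G" "Suc (card A) = n"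
  shows "adj n F G"
proof -
  have "card (F \<inter> G) < card F"
    using assms by (metis card_seteq inf_le1 inf_le2 linorder_not_le order_antisym card_mono)
  moreover have "card A \<le> card (F \<inter> G)"
    using assms by (intro card_mono) auto
  ultimately show ?thesis
    using assms by (simp add: adj_def)
qed

lemma pure_leaf_Int:
  assumes S: "leafy n S" "T \<subseteq> S" and L: "pure_leaf n T L"
    and H: "H \<in> T" "adj n L H" and K: "K \<in> T" "adj n L K"
  shows "L \<inter> H = L \<inter> K"
proof -
  have "L \<in> S" "H \<in> S" "K \<in> S" using assms by (auto simp: pure_leaf_def)
  then have fin: "finite L" "H \<noteq> L" "K \<noteq> L"
    using S(1) H(2) K(2) by (auto simp: leafy_def dest: not_adj_refl)
  then have "L \<inter> H \<subseteq> L \<inter> K" "L \<inter> K \<subseteq> L \<inter> H"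
    using L H K by (auto simp: pure_leaf_def)
  then show ?thesis by blast
qed

text \<open>All neighbours of a leaf meet it in the same face of size \<open>n - 1\<close>, which is
  then common to any two of them. Leaves are thus simplicial vertices of the adjacency
  graph.\<close>

lemma pure_leaf_neighbours:
  assumes S: "leafy n S" "T \<subseteq> S" and L: "pure_leaf n T L"
    and H: "H \<in> T" "adj n L H" and K: "K \<in> T" "adj n L K" and "H \<noteq> K"
  shows "adj n H K"
proof (rule adjI)
  show "L \<inter> H \<subseteq> H \<inter> K" using pure_leaf_Int[OF S L H K] by blast
  show "Suc (card (L \<inter> H)) = n" using H by (simp add: adj_def)
qed (use assms leafy_card[OF S(1)] in auto)

text \<open>One of the three sets is a leaf of the triangle and meets the other two in one face. By
  its size \<open>n - 1\<close> this face is also the intersection of those two.\<close>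

lemma adj_triangle_Int:
  assumes S: "leafy n S" and "a \<in> S" "b \<in> S" "c \<in> S" and e: "adj n a b" "adj n b c" "adj n a c"
  shows "a \<inter> b \<subseteq> c"
proof -
  have fin: "finite a" "finite b" "finite c"
    using assms leafy_card by metis+
  obtain L where L: "pure_leaf n {a, b, c} L"
    using leafy_pure_leaf[OF S, of "{a, b, c}"] assms by auto
  have sub: "{a, b, c} \<subseteq> S" using assms by auto
  note I = pure_leaf_Int[OF S sub L]
  have e': "adj n b a" "adj n c b" "adj n c a" using e by (simp_all add: adj_commute)
  consider "L = a" | "L = b" | "L = c" using L by (auto simp: pure_leaf_def)
  then show ?thesis
  proof cases
    case 1 then show ?thesis using I[of b c] e by blast
  next
    case 2 then show ?thesis using I[of a c] e e' by blast
  next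
    case 3
    then have eq: "c \<inter> a = c \<inter> b" using I[of a b] e e' by blast
    then have "c \<inter> a \<subseteq> a \<inter> b" by blast
    moreover have "card (c \<inter> a) = card (a \<inter> b)" using e e' by (simp add: adj_def)
    ultimately have "c \<inter> a = a \<inter> b" using fin by (intro card_subset_eq) auto
    then show ?thesis by blast
  qed
qed

text \<open>Both triangles over the edge from \<open>y\<close> to \<open>z\<close> contain
  \<open>y \<inter> z\<close>, a set of size \<open>n - 1\<close>, so \<open>x\<close> and
  \<open>p\<close> share it.\<close>

lemma diamond_free:
  assumes S: "leafy n S" and "x \<in> S" "y \<in> S" "z \<in> S" "p \<in> S"
    and e: "adj n x y" "adj n x z" "adj n y z" "adj n p y" "adj n p z" and "p \<noteq> x"
  shows "adj n x p"
proof (rule adjI)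
  have "adj n z x" "adj n z p" using e by (simp_all add: adj_commute)
  then show "y \<inter> z \<subseteq> x \<inter> p"
    using adj_triangle_Int[OF S, of y z x] adj_triangle_Int[OF S, of y z p] assms
    by (simp add: adj_commute)
  show "Suc (card (y \<inter> z)) = n" using e by (simp add: adj_def)
qed (use assms leafy_card[OF S] in auto)

section \<open>Chordless paths and their uniqueness\<close>

definition induced_path :: "nat \<Rightarrow> 'v set list \<Rightarrow> bool" where
  "induced_path n P \<longleftrightarrow> P \<noteq> [] \<and> distinct P \<and>
     (\<forall>i j. i < j \<longrightarrow> j < length P \<longrightarrow> (adj n (P ! i) (P ! j) \<longleftrightarrow> j = Suc i))"

lemma induced_path_adj: "induced_path n P \<Longrightarrow> Suc i < length P \<Longrightarrow> adj n (P ! i) (P ! Suc i)"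
  by (simp add: induced_path_def)

lemma induced_path_rev:
  assumes "induced_path n P"
  shows "induced_path n (rev P)"
  unfolding induced_path_def
proof (intro conjI allI impI)
  fix i j assume ij: "i < j" "j < length (rev P)"
  let ?i = "length P - Suc j" and ?j = "length P - Suc i"
  have "adj n (rev P ! i) (rev P ! j) \<longleftrightarrow> adj n (P ! ?i) (P ! ?j)"
    using ij by (simp add: rev_nth adj_commute)
  also have "\<dots> \<longleftrightarrow> ?j = Suc ?i"
    using assms ij by (simp add: induced_path_def)
  also have "\<dots> \<longleftrightarrow> j = Suc i" using ij by auto
  finally show "adj n (rev P ! i) (rev P ! j) \<longleftrightarrow> j = Suc i" .
qed (use assms in \<open>auto simp: induced_path_def\<close>)

lemma induced_path_drop:
  assumes "induced_path n P" "t < length P"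
  shows "induced_path n (drop t P)"
  using assms by (auto simp: induced_path_def)

lemma induced_path_Cons:
  assumes P: "induced_path n P" and "adj n x (hd P)" "x \<notin> set P" "\<And>z. z \<in> set (tl P) \<Longrightarrow> \<not> adj n x z"
  shows "induced_path n (x # P)"
  unfolding induced_path_def
proof (intro conjI allI impI)
  fix i j assume ij: "i < j" "j < length (x # P)"
  then obtain j' where j': "j = Suc j'" by (cases j) auto
  show "adj n ((x # P) ! i) ((x # P) ! j) \<longleftrightarrow> j = Suc i"
  proof (cases i)
    case 0
    show ?thesis
    proof (cases j')
      case 0
      then show ?thesis using \<open>i = 0\<close> j' P assms(2) by (simp add: induced_path_def hd_conv_nth)
    next
      case (Suc k)
      then have "P ! j' = tl P ! k" "k < length (tl P)"
        using ij j' by (auto simp: nth_tl)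
      then show ?thesis using \<open>i = 0\<close> j' Suc assms(4) by auto
    qed
  next
    case (Suc i')
    then show ?thesis using ij j' P by (simp add: induced_path_def)
  qed
qed (use assms in \<open>auto simp: induced_path_def\<close>)

lemma induced_path_Cons_tail:
  assumes "induced_path n (x # y # P)"
  shows "adj n x y" "\<And>z. z \<in> set P \<Longrightarrow> \<not> adj n x z" "induced_path n (y # P)" "x \<notin> set (y # P)"
proof -
  show "adj n x y" using induced_path_adj[OF assms, of 0] by simp
  show "\<not> adj n x z" if z: "z \<in> set P" for z
  proof -
    obtain k where "k < length P" "z = P ! k" using z by (metis in_set_conv_nth)
    moreover from this have "adj n ((x # y # P) ! 0) ((x # y # P) ! Suc (Suc k)) \<longleftrightarrow> Suc (Suc k) = Suc 0"
      using assms unfolding induced_path_def by (metis length_Cons Suc_less_eq zero_less_Suc)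
    ultimately show ?thesis by simp
  qed
  show "induced_path n (y # P)" using induced_path_drop[OF assms, of 1] by simp
  show "x \<notin> set (y # P)" using assms by (auto simp: induced_path_def)
qed

text \<open>The two path neighbours of an inner leaf would be adjacent to each other, which is a
  chord.\<close>

lemma induced_path_inner_not_leaf:
  assumes S: "leafy n S" "T \<subseteq> S" and P: "induced_path n P" "set P \<subseteq> T"
    and t: "0 < t" "Suc t < length P"
  shows "\<not> pure_leaf n T (P ! t)"
proof
  assume L: "pure_leaf n T (P ! t)"
  have "adj n (P ! (t - 1)) (P ! t)" "adj n (P ! t) (P ! Suc t)"
    using induced_path_adj[OF P(1), of "t - 1"] induced_path_adj[OF P(1), of t] t by auto
  moreover have "P ! (t - 1) \<noteq> P ! Suc t"
    using P(1) t by (auto simp: induced_path_def nth_eq_iff_index_eq)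
  moreover have "P ! (t - 1) \<in> T" "P ! Suc t \<in> T"
    using P(2) t nth_mem[of "t - 1" P] nth_mem[of "Suc t" P] by auto
  ultimately have "adj n (P ! (t - 1)) (P ! Suc t)"
    using pure_leaf_neighbours[OF S L] by (simp add: adj_commute)
  moreover have "\<not> adj n (P ! (t - 1)) (P ! Suc t)"
    using P(1) t unfolding induced_path_def by auto
  ultimately show False by blast
qed

lemma induced_path_avoids_leaf:
  assumes S: "leafy n S" "T \<subseteq> S" and P: "induced_path n P" "set P \<subseteq> T"
    and L: "pure_leaf n T L" "hd P \<noteq> L" "last P \<noteq> L"
  shows "L \<notin> set P"
proof
  assume "L \<in> set P"
  then obtain t where t: "t < length P" "P ! t = L" by (metis in_set_conv_nth)
  have "P \<noteq> []" using P by (auto simp: induced_path_def)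
  then have "P ! 0 \<noteq> L" "P ! (length P - 1) \<noteq> L"
    using L by (simp_all add: hd_conv_nth last_conv_nth)
  then have "t \<noteq> 0" "t \<noteq> length P - 1"
    using t by (metis, metis)
  then have "0 < t" "Suc t < length P"
    using t by auto
  then show False
    using induced_path_inner_not_leaf[OF S P] t L by blast
qed

text \<open>If the second facets \<open>p\<close> and \<open>q\<close> differ, they are adjacent as
  neighbours of the leaf. Prolonging a tail of one path by \<open>q\<close> yields a chordless path
  inside \<open>S - {L}\<close> that competes with a known one. Uniqueness in \<open>S - {L}\<close>
  is a hypothesis so that the step also serves for reversed paths.\<close>

lemma induced_path_unique_step:
  assumes S: "leafy n S"
    and IH: "\<And>P Q. induced_path n P \<Longrightarrow> induced_path n Q \<Longrightarrow> set P \<subseteq> S - {L} \<Longrightarrow> set Q \<subseteq> S - {L} \<Longrightarrow>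
      hd P = hd Q \<Longrightarrow> last P = last Q \<Longrightarrow> P = Q"
    and L: "pure_leaf n S L"
    and P: "induced_path n P" "set P \<subseteq> S" "hd P = L"
    and Q: "induced_path n Q" "set Q \<subseteq> S" "hd Q = L"
    and last: "last P = last Q"
  shows "P = Q"
proof -
  have ne: "P \<noteq> []" "Q \<noteq> []" using P Q by (auto simp: induced_path_def)
  then obtain P1 Q1 where P1: "P = L # P1" and Q1: "Q = L # Q1"
    using P(3) Q(3) by (metis list.exhaust_sel)
  have dist: "distinct P" "distinct Q" using P Q by (auto simp: induced_path_def)
  consider "P1 = []" | "Q1 = []" | p P' q Q' where "P1 = p # P'" "Q1 = q # Q'"
    by (cases P1; cases Q1) auto
  then show ?thesis
  proof cases
    case 1
    then have "Q1 = []" using last dist P1 Q1 by (cases Q1 rule: rev_cases) auto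
    with 1 P1 Q1 show ?thesis by simp
  next
    case 2
    then have "P1 = []" using last dist P1 Q1 by (cases P1 rule: rev_cases) auto
    with 2 P1 Q1 show ?thesis by simp
  next
    case 3
    note PT = induced_path_Cons_tail[OF P(1)[unfolded P1 3]]
    note QT = induced_path_Cons_tail[OF Q(1)[unfolded Q1 3]]
    let ?R = "p # P'"
    have RS: "set ?R \<subseteq> S - {L}" "set (q # Q') \<subseteq> S - {L}"
      using P Q P1 Q1 3 PT(4) QT(4) by auto
    have lastR: "last ?R = last (q # Q')" using last P1 Q1 3 by simp
    have "p = q"
    proof (rule ccontr)
      assume "p \<noteq> q"
      have pq: "adj n p q"
        using pure_leaf_neighbours[OF S order_refl L, of p q] PT(1) QT(1) \<open>p \<noteq> q\<close> RS by auto
      have pQ: "p \<notin> set Q'" using PT(1) QT(2) by blast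
      have qP: "q \<notin> set P'" using QT(1) PT(2) by blast
      \<comment> \<open>The last neighbour of \<open>q\<close> on \<open>?R\<close>: from there on,
        \<open>q\<close> followed by the rest of \<open>?R\<close> has no chord.\<close>
      define t where "t = Max {i. i < length ?R \<and> adj n q (?R ! i)}"
      have fin: "finite {i. i < length ?R \<and> adj n q (?R ! i)}" by simp
      have "0 \<in> {i. i < length ?R \<and> adj n q (?R ! i)}" using pq by (simp add: adj_commute)
      then have "t \<in> {i. i < length ?R \<and> adj n q (?R ! i)}"
        unfolding t_def using Max_in[OF fin] by blast
      then have t: "t < length ?R" "adj n q (?R ! t)" by auto
      have tmax: "i \<le> t" if "i < length ?R" "adj n q (?R ! i)" for i
        unfolding t_def using fin that by (intro Max_ge) auto
      have sub: "set (drop t ?R) \<subseteq> S - {L}"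
        using RS(1) set_drop_subset[of t ?R] by (rule subset_trans[rotated])
      have qd: "induced_path n (q # drop t ?R)"
      proof (rule induced_path_Cons)
        show "induced_path n (drop t ?R)" using PT(3) t(1) by (rule induced_path_drop)
        show "adj n q (hd (drop t ?R))" using t by (simp add: hd_drop_conv_nth)
        show "q \<notin> set (drop t ?R)"
          using set_drop_subset[of t ?R] qP \<open>p \<noteq> q\<close> by auto
        fix z assume "z \<in> set (tl (drop t ?R))"
        then have "z \<in> set (drop (Suc t) ?R)" by (simp add: drop_Suc tl_drop)
        then obtain k where "k < length (drop (Suc t) ?R)" "z = drop (Suc t) ?R ! k"
          by (metis in_set_conv_nth)
        then have "Suc t + k < length ?R" "z = ?R ! (Suc t + k)"
          using t(1) by simp_all
        then show "\<not> adj n q z" using tmax[of "Suc t + k"] by fastforce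
      qed
      have lastd: "last (drop t ?R) = last ?R" using t(1) by (intro last_drop) auto
      consider "t = 0" | "t = 1" | "2 \<le> t" by linarith
      then show False
      proof cases
        \<comment> \<open>Here \<open>q\<close> followed by all of \<open>?R\<close> is chordless,
          so it equals the tail of \<open>Q\<close>. Then \<open>p\<close>, a neighbour of
          \<open>L\<close>, occurs in \<open>Q'\<close>, which is a chord of
          \<open>Q\<close>.\<close>
        case 1
        then have "q # ?R = q # Q'"
          using qd RS lastR by (intro IH) (use QT(3) in auto)
        then show False using pQ by auto
      next
        \<comment> \<open>The triangles \<open>L\<close>, \<open>p\<close>, \<open>q\<close> and
          \<open>r\<close>, \<open>p\<close>, \<open>q\<close> form a diamond, which forces the
          chord from \<open>L\<close> to \<open>r\<close> in \<open>P\<close>.\<close>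
        case 2
        then obtain r where r: "r \<in> set P'" "?R ! 1 = r"
          using t(1) by (cases P') auto
        have "adj n p r" using induced_path_adj[OF PT(3), of 0] 2 t(1) r by simp
        then have "adj n L r"
          using diamond_free[OF S, of L p q r] PT(1) QT(1) pq t(2) 2 r RS L
          by (auto simp: pure_leaf_def adj_commute)
        then show False using PT(2) r by blast
      next
        \<comment> \<open>The detour over \<open>q\<close> is a second chordless path from
          \<open>p\<close> to the end of \<open>?R\<close>, since \<open>drop t ?R\<close> lies
          beyond the successor of \<open>p\<close>. By uniqueness \<open>q\<close> would occur in
          \<open>P'\<close>.\<close>
        case 3
        have "induced_path n (p # q # drop t ?R)"
        proof (rule induced_path_Cons[OF qd])
          have dp: "set (drop t ?R) \<subseteq> set (drop 1 P')"
          proof -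
            obtain s where "t = Suc (Suc s)" using 3 by (metis add_2_eq_Suc le_Suc_ex)
            then show ?thesis using set_drop_subset[of s "drop 1 P'"] by (simp add: drop_Suc)
          qed
          show "adj n p (hd (q # drop t ?R))" using pq by simp
          show "p \<notin> set (q # drop t ?R)"
            using dp \<open>p \<noteq> q\<close> PT(3) set_drop_subset[of 1 P'] by (auto simp: induced_path_def)
          fix z assume "z \<in> set (tl (q # drop t ?R))"
          then have "z \<in> set (drop 1 P')" using dp by auto
          moreover obtain r P'' where "P' = r # P''" using 3 t(1) by (cases P') auto
          ultimately show "\<not> adj n p z" using induced_path_Cons_tail(2)[of n p r P''] PT(3) by auto
        qed
        moreover have "last (p # q # drop t ?R) = last ?R"
          using lastd t(1) by simp
        ultimately have "p # q # drop t ?R = ?R"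
          using RS sub PT(3) by (intro IH) auto
        then have "q \<in> set P'" by (metis list.inject list.set_intros(1))
        then show False using qP by blast
      qed
    qed
    moreover have "?R = q # Q'"
      using PT(3) QT(3) RS lastR \<open>p = q\<close> by (intro IH) auto
    ultimately show ?thesis using P1 Q1 3 by simp
  qed
qed

text \<open>Remove a leaf \<open>L\<close> of the whole family. Two paths with the same ends both
  start at \<open>L\<close>, both end at \<open>L\<close>, or both avoid it.\<close>

lemma induced_path_unique:
  assumes "finite S" "leafy n S"
    and "induced_path n P" "set P \<subseteq> S" "induced_path n Q" "set Q \<subseteq> S"
    and "hd P = hd Q" "last P = last Q"
  shows "P = Q"
  using assms
proof (induction "card S" arbitrary: S P Q rule: less_induct)
  case less
  have ne: "P \<noteq> []" "Q \<noteq> []" using less.prems by (auto simp: induced_path_def)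
  then have "S \<noteq> {}" using less.prems by (cases P) auto
  then obtain L where L: "pure_leaf n S L" using less.prems leafy_pure_leaf by blast
  then have "L \<in> S" by (simp add: pure_leaf_def)
  have IH: "P = Q" if "induced_path n P" "induced_path n Q" "set P \<subseteq> S - {L}" "set Q \<subseteq> S - {L}"
    "hd P = hd Q" "last P = last Q" for P Q
    using that less.prems(1,2) \<open>L \<in> S\<close>
    by (intro less.hyps[of "S - {L}"] card_Diff1_less) (auto intro: leafy_subset)
  note step = induced_path_unique_step[OF less.prems(2) IH L]
  consider "hd P = L" | "last P = L" | "hd P \<noteq> L" "last P \<noteq> L" by blast
  then show ?case
  proof cases
    case 1
    with less.prems show ?thesis by (intro step) auto
  next
    case 2
    with less.prems ne have "rev P = rev Q"
      by (intro step induced_path_rev) (auto simp: hd_rev last_rev)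
    then show ?thesis by simp
  next
    case 3
    then have "L \<notin> set P" "L \<notin> set Q"
      using induced_path_avoids_leaf[OF less.prems(2) order_refl _ _ L] less.prems by auto
    then show ?thesis using less.prems by (intro IH) auto
  qed
qed

text \<open>The segment from \<open>i\<close> to \<open>j\<close> has a leaf, and this must be one
  of its ends. The leaf condition moves the intersection to the neighbour of that end, and the
  segment gets shorter.\<close>

lemma induced_path_running_intersection:
  assumes S: "leafy n S" and P: "induced_path n P" "set P \<subseteq> S"
    and "i \<le> u" "u \<le> j" "j < length P"
  shows "P ! i \<inter> P ! j \<subseteq> P ! u"
  using assms(4-)
proof (induction "j - i" arbitrary: i j rule: less_induct)
  case less
  show ?case
  proof (cases "i = u \<or> u = j")
    case False
    then have iuj: "i < u" "u < j" using less.prems by auto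
    let ?Q = "drop i (take (Suc j) P)"
    have Qn: "?Q ! t = P ! (i + t)" if "t \<le> j - i" for t
      using that less.prems by auto
    have lenQ: "length ?Q = Suc (j - i)" using less.prems by auto
    have Q: "induced_path n ?Q"
      unfolding induced_path_def
    proof (intro conjI allI impI)
      show "?Q \<noteq> []" using lenQ by (metis list.size(3) nat.distinct(1))
      show "distinct ?Q" using P(1) by (simp add: induced_path_def)
      fix a b assume "a < b" "b < length ?Q"
      then show "adj n (?Q ! a) (?Q ! b) \<longleftrightarrow> b = Suc a"
        using P(1) lenQ less.prems by (simp add: induced_path_def)
    qed
    have QS: "set ?Q \<subseteq> S" using P(2) by (meson in_set_dropD in_set_takeD subsetD subsetI)
    obtain L where L: "pure_leaf n (set ?Q) L"
      using leafy_pure_leaf[OF S QS] Q by (auto simp: induced_path_def)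
    then have "L \<in> set ?Q" by (simp add: pure_leaf_def)
    then obtain t where t: "t \<le> j - i" "?Q ! t = L" by (metis in_set_conv_nth lenQ less_Suc_eq_le)
    have "t = 0 \<or> t = j - i"
      using induced_path_inner_not_leaf[OF S QS Q order_refl, of t] t L lenQ by fastforce
    have mem: "P ! v \<in> set ?Q" if "i \<le> v" "v \<le> j" for v
      using nth_mem[of "v - i" ?Q] Qn[of "v - i"] lenQ that by auto
    have neq: "P ! i \<noteq> P ! j"
      using P(1) iuj less.prems by (auto simp: induced_path_def nth_eq_iff_index_eq)
    from \<open>t = 0 \<or> t = j - i\<close> show ?thesis
    proof
      assume "t = 0"
      then have "L = P ! i" using t Qn[of 0] by simp
      moreover have "adj n (P ! i) (P ! Suc i)"
        using induced_path_adj[OF P(1), of i] less.prems iuj by simp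
      ultimately have "P ! i \<inter> P ! j \<subseteq> P ! Suc i"
        using pure_leafD[OF L, of "P ! Suc i" "P ! j"] mem[of "Suc i"] mem[of j] iuj neq by simp
      moreover have "P ! Suc i \<inter> P ! j \<subseteq> P ! u"
        using less.hyps[of j "Suc i"] less.prems iuj by auto
      ultimately show ?thesis by blast
    next
      assume "t = j - i"
      then have "L = P ! j" using t Qn[of "j - i"] iuj by simp
      moreover have "adj n (P ! j) (P ! (j - 1))"
        using induced_path_adj[OF P(1), of "j - 1"] less.prems iuj by (simp add: adj_commute)
      ultimately have "P ! i \<inter> P ! j \<subseteq> P ! (j - 1)"
        using pure_leafD[OF L, of "P ! (j - 1)" "P ! i"] mem[of "j - 1"] mem[of i] iuj neq
        by (simp add: Int_commute)
      moreover have "P ! i \<inter> P ! (j - 1) \<subseteq> P ! u"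
        using less.hyps[of "j - 1" i] less.prems iuj by auto
      ultimately show ?thesis by blast
    qed
  qed blast
qed

section \<open>Lengths of chordless paths\<close>

lemma adj_Diff:
  assumes "adj n F G" "finite G" "card G = n"
  obtains w where "G - F = {w}"
proof -
  have "card (G - F) = card G - card (G \<inter> F)"
    using assms by (intro card_Diff_subset_Int) auto
  then have "card (G - F) = 1"
    using assms unfolding adj_def by (simp add: Int_commute)
  then show ?thesis by (metis card_1_singletonE that)
qed

text \<open>Each step brings in at most one vertex outside \<open>X\<close>. The set
  \<open>X\<close> is left free so that a vertex already spent can be put into it.\<close>

lemma card_last_Diff_le:
  assumes "successively (adj n) P" "P \<noteq> []" "\<And>F. F \<in> set P \<Longrightarrow> finite F \<and> card F = n"
  shows "card (last P - X) \<le> card (hd P - X) + (length P - 1)"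
  using assms
proof (induction P rule: induct_list012)
  case (3 F G P)
  have "adj n F G" "finite F" "finite G" "card G = n" using 3 by auto
  then obtain w where "G - F = {w}" by (metis adj_Diff)
  then have "G - X \<subseteq> insert w (F - X)" by blast
  then have "card (G - X) \<le> card (insert w (F - X))"
    using \<open>finite F\<close> by (intro card_mono) auto
  also have "\<dots> \<le> Suc (card (F - X))" using \<open>finite F\<close> by (simp add: card_insert_if)
  finally have "card (G - X) \<le> Suc (card (F - X))" .
  moreover have "card (last (G # P) - X) \<le> card (hd (G # P) - X) + (length (G # P) - 1)"
    using "3.prems" by (intro "3.IH") auto
  ultimately show ?case by simp
qed auto

text \<open>By the running intersection property, a vertex added along the path does not come from \<open>hd P\<close>,
  so it belongs to \<open>last P\<close> and is never dropped again.\<close>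

lemma induced_path_length:
  assumes S: "leafy n S" and P: "induced_path n P" "set P \<subseteq> S"
    and sub: "\<And>H. H \<in> set P \<Longrightarrow> H \<subseteq> hd P \<union> last P"
  shows "length P = Suc (card (last P - hd P))"
proof -
  have "P \<noteq> []" using P by (simp add: induced_path_def)
  then have hd: "hd P = P ! 0" and last: "last P = P ! (length P - 1)"
    by (simp_all add: hd_conv_nth last_conv_nth)
  note run = induced_path_running_intersection[OF S P]
  have "card (P ! t - P ! 0) = t" if "t < length P" for t
    using that
  proof (induction t)
    case (Suc t)
    have fin: "finite (P ! t)" "finite (P ! Suc t)" "card (P ! Suc t) = n"
      using leafy_card[OF S] P(2) Suc.prems by (auto simp: subset_iff)
    obtain w where w: "P ! Suc t - P ! t = {w}"
      using adj_Diff[OF induced_path_adj[OF P(1) Suc.prems] fin(2,3)] by blast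
    have "P ! 0 \<inter> P ! Suc t \<subseteq> P ! t"
      using run[of 0 t "Suc t"] Suc.prems by simp
    moreover have "P ! t \<inter> P ! (length P - 1) \<subseteq> P ! Suc t"
      using run[of t "Suc t" "length P - 1"] Suc.prems by simp
    moreover have "P ! t \<subseteq> P ! 0 \<union> P ! (length P - 1)"
      using sub[of "P ! t"] Suc.prems by (simp add: hd last)
    ultimately have "P ! Suc t - P ! 0 = insert w (P ! t - P ! 0)" "w \<notin> P ! t"
      using w by blast+
    then show ?case using Suc fin by simp
  qed simp
  from this[of "length P - 1"] show ?thesis
    using \<open>P \<noteq> []\<close> by (simp add: hd last)
qed

text \<open>A path of this length has no step to spare: if the first new vertex were not in
  \<open>last P\<close>, the remaining steps could not collect all of
  \<open>last P - hd P\<close>.\<close>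

lemma induced_path_first_step:
  assumes S: "leafy n S" and P: "induced_path n P" "set P \<subseteq> S"
    and len: "length P = Suc (card (last P - hd P))" and ne: "hd P \<noteq> last P"
  obtains H w where "H \<in> set P" "H \<noteq> hd P" "adj n (hd P) H" "H - hd P = {w}" "w \<in> last P"
proof -
  obtain F H Q where PF: "P = F # H # Q"
    using P ne by (cases P rule: remdups_adj.cases) (auto simp: induced_path_def)
  have FH: "adj n F H" using induced_path_Cons_tail(1) P PF by blast
  have fin: "finite X \<and> card X = n" if "X \<in> set P" for X
    using that P leafy_card[OF S] by blast
  then obtain w where w: "H - F = {w}"
    using adj_Diff[OF FH] PF by auto
  have succ: "successively (adj n) (H # Q)"
  proof -
    have "\<forall>i. Suc i < length P \<longrightarrow> adj n (P ! i) (P ! Suc i)"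
      using induced_path_adj[OF P(1)] by blast
    then have "successively (adj n) P" by (simp add: successively_conv_nth)
    then show ?thesis using PF by simp
  qed
  have "w \<in> last P"
  proof (rule ccontr)
    assume "w \<notin> last P"
    then have "last (H # Q) - F = last (H # Q) - insert w F" using PF by auto
    also have "card \<dots> \<le> card (H - insert w F) + (length (H # Q) - 1)"
      using card_last_Diff_le[OF succ, of "insert w F"] fin PF by simp
    also have "H - insert w F = {}" using w by blast
    finally show False using len PF by simp
  qed
  then show ?thesis using that[of H w] w FH PF P(1) by (auto simp: induced_path_def)
qed

section \<open>Linear syzygies of facet ideals\<close>

lemma mon_degree_eq_0: "mon_degree m = 0 \<longleftrightarrow> m = 0"
proof
  assume "mon_degree m = 0"
  then have "Poly_Mapping.lookup m v = 0" for v
    by (cases "v \<in> Poly_Mapping.keys m") (auto simp: mon_degree_def in_keys_iff)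
  then show "m = 0" by (intro poly_mapping_eqI) simp
qed (simp add: mon_degree_def)

lemma card_keys_le_mon_degree: "card (Poly_Mapping.keys m) \<le> mon_degree m"
proof -
  have "card (Poly_Mapping.keys m) = (\<Sum>v\<in>Poly_Mapping.keys m. 1)" by simp
  also have "\<dots> \<le> mon_degree m"
    unfolding mon_degree_def by (intro sum_mono) (simp add: in_keys_iff Suc_leI)
  finally show ?thesis .
qed

lemma keys_split:
  fixes p :: "('v, 'k::field) mpoly"
  obtains p1 p2 where "p = p1 + p2" "Poly_Mapping.keys p1 \<subseteq> Poly_Mapping.keys p \<inter> S"
    "Poly_Mapping.keys p2 \<subseteq> Poly_Mapping.keys p - S"
proof -
  let ?f = "\<lambda>m. Poly_Mapping.single m (Poly_Mapping.lookup p m)"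
  have "p = (\<Sum>m\<in>Poly_Mapping.keys p \<inter> S. ?f m) + (\<Sum>m\<in>Poly_Mapping.keys p - S. ?f m)"
    using poly_mapping_sum_singles[of p] sum.Int_Diff[OF finite_keys, of ?f p S] by simp
  moreover have "Poly_Mapping.keys (sum ?f A) \<subseteq> A" for A
    by (auto elim!: keys_sum_mem split: if_splits)
  ultimately show ?thesis using that by blast
qed

lemma facets_subset_eq: "F \<in> facets \<Delta> \<Longrightarrow> G \<in> facets \<Delta> \<Longrightarrow> F \<subseteq> G \<Longrightarrow> F = G"
  by (auto simp: facets_def)

text \<open>Let \<open>C\<close> be the component of \<open>F\<close> among the facets inside \<open>F \<union> G\<close>. Truncating the generators
  to the monomials of the facets in \<open>C\<close> sends every linear syzygy to a form without monomials
  dividing \<open>x\<^bsub>F\<union>G\<^esub>\<close>, since two facets in such a monomial of degree \<open>n + 1\<close> are adjacent. The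
  syzygy between \<open>x\<^sub>F\<close> and \<open>x\<^sub>G\<close> is sent to \<open>x\<^bsub>F\<union>G\<^esub>\<close> if \<open>G\<close> is not in \<open>C\<close>.\<close>

lemma linear_resolution_facets:
  assumes sc: "simplicial_complex V \<Delta>"
    and lin: "has_linear_resolution V (facet_ideal V \<Delta> :: ('v, 'k::field) mpoly set)"
  shows "\<exists>n. (\<forall>F\<in>facets \<Delta>. card F = n) \<and> (\<forall>F\<in>facets \<Delta>. \<forall>G\<in>facets \<Delta>.
    (F, G) \<in> {(H, H'). H \<in> facets \<Delta> \<and> H' \<in> facets \<Delta> \<and> H \<union> H' \<subseteq> F \<union> G \<and> adj n H H'}\<^sup>*)"
proof -
  let ?I = "facet_ideal V \<Delta> :: ('v, 'k) mpoly set"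
  let ?x = "\<lambda>F. Poly_Mapping.single (face_mon F) 1 :: ('v, 'k) mpoly"
  obtain b a g D d where res: "graded_free_resolution V ?I b a g D" and a: "\<And>i j. j < b i \<Longrightarrow> a i j = d + int i"
    using lin unfolding has_linear_resolution_def minimal_graded_free_resolution_def by blast
  have g: "g \<in> free_mod V (b 0)" and ghom: "\<And>j. j < b 0 \<Longrightarrow> homogeneous d (g $ j)"
    and D: "D 0 \<in> carrier_mat (b 0) (b 1)"
    and Dhom: "\<And>j k. j < b 0 \<Longrightarrow> k < b 1 \<Longrightarrow> homogeneous 1 (D 0 $$ (j, k))"
    and I: "(\<lambda>u. g \<bullet> u) ` free_mod V (b 0) = ?I"
    and ker: "(\<lambda>u. D 0 *\<^sub>v u) ` free_mod V (b 1) = {u \<in> free_mod V (b 0). g \<bullet> u = 0}"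
  proof -
    note R = res[unfolded graded_free_resolution_def]
    note r = R[THEN conjunct1]
      R[THEN conjunct2, THEN conjunct1]
      R[THEN conjunct2, THEN conjunct2, THEN conjunct1]
      R[THEN conjunct2, THEN conjunct2, THEN conjunct2, THEN conjunct1]
      R[THEN conjunct2, THEN conjunct2, THEN conjunct2, THEN conjunct2, THEN conjunct1]
      R[THEN conjunct2, THEN conjunct2, THEN conjunct2, THEN conjunct2, THEN conjunct2, THEN conjunct1]
    show "g \<in> free_mod V (b 0)" by (rule r(1))
    show "homogeneous d (g $ j)" if "j < b 0" for j
      using r(2)[rule_format, OF that] a[OF that] by simp
    show "D 0 \<in> carrier_mat (b 0) (b 1)" using r(3)[rule_format, of 0] by simp
    show "homogeneous 1 (D 0 $$ (j, k))" if jk: "j < b 0" "k < b 1" for j k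
      using r(4)[rule_format, of j 0 k] jk a[of j 0] a[of k "Suc 0"] by simp
    show "(\<lambda>u. g \<bullet> u) ` free_mod V (b 0) = ?I" by (rule r(5))
    show "(\<lambda>u. D 0 *\<^sub>v u) ` free_mod V (b 1) = {u \<in> free_mod V (b 0). g \<bullet> u = 0}" by (rule r(6))
  qed
  have fin: "finite F" and sub: "F \<subseteq> V" if "F \<in> facets \<Delta>" for F
    using that sc finite_subset[of F V] by (auto simp: simplicial_complex_def facets_def)
  have gu: "g \<bullet> u = (\<Sum>j<b 0. g $ j * u $ j)" if "u \<in> free_mod V (b 0)" for u
    using that by (auto simp: scalar_prod_def free_mod_def lessThan_atLeast0)
  have unit: "unit_vec r j \<in> free_mod V r" for r j
    by (auto simp: free_mod_def unit_vec_def poly_ring_iff)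
  have gI: "g $ j \<in> ?I" if "j < b 0" for j
  proof -
    have "g \<bullet> unit_vec (b 0) j = g $ j"
      using g that by (intro scalar_prod_right_unit) (auto simp: free_mod_def)
    then show ?thesis using I unit by (metis imageI)
  qed
  have xI: "?x F \<in> ?I" if "F \<in> facets \<Delta>" for F
    using that fin[OF that] sub[OF that] unfolding facet_ideal_iff[OF sc]
    by (auto simp: keys_face_mon intro: single_face_mon_in_poly_ring)
  \<comment> \<open>A monomial of some generator divides the monomial of \<open>F\<close> and is
    divisible by that of a facet, which can only be \<open>F\<close>. Hence a monomial of degree
    \<open>d\<close> equals that of \<open>F\<close>.\<close>
  have cardF: "int (card F) = d" if F: "F \<in> facets \<Delta>" for F
  proof -
    obtain u where u: "u \<in> free_mod V (b 0)" "?x F = g \<bullet> u" using xI[OF F] I by blast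
    have "face_mon F \<in> Poly_Mapping.keys (\<Sum>j<b 0. g $ j * u $ j)"
      unfolding gu[OF u(1), symmetric] u(2)[symmetric] by simp
    then obtain j where j: "j < b 0" "face_mon F \<in> Poly_Mapping.keys (g $ j * u $ j)"
      by (auto elim: keys_sum_mem)
    then obtain m c where mc: "face_mon F = m + c" "m \<in> Poly_Mapping.keys (g $ j)"
      using keys_mult[of "g $ j" "u $ j"] by blast
    then obtain H where H: "H \<in> facets \<Delta>" "H \<subseteq> Poly_Mapping.keys m"
      using gI[OF j(1)] unfolding facet_ideal_iff[OF sc] by blast
    have "Poly_Mapping.keys m \<subseteq> F"
      using arg_cong[OF mc(1), of Poly_Mapping.keys] fin[OF F] by (auto simp: keys_face_mon keys_add_nat)
    then have "H = F" using H F facets_subset_eq by blast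
    then obtain m' where "m = face_mon F + m'" using H fin[OF F] by (metis face_mon_dvd)
    then have "mon_degree m = card F"
      using arg_cong[OF mc(1), of mon_degree] fin[OF F] by (simp add: mon_degree_add mon_degree_face_mon)
    then show ?thesis using ghom[OF j(1)] mc(2) by (auto simp: homogeneous_def)
  qed
  define n where "n = nat d"
  have card: "card F = n" if "F \<in> facets \<Delta>" for F
    using cardF[OF that] by (simp add: n_def)
  have gkeys: "\<exists>H\<in>facets \<Delta>. m = face_mon H" if j: "j < b 0" and m: "m \<in> Poly_Mapping.keys (g $ j)" for j m
  proof -
    obtain H where H: "H \<in> facets \<Delta>" "H \<subseteq> Poly_Mapping.keys m"
      using gI[OF j] m unfolding facet_ideal_iff[OF sc] by blast
    then obtain m' where m': "m = face_mon H + m'" using fin by (metis face_mon_dvd)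
    have "int (mon_degree m) = d" using ghom[OF j] m by (auto simp: homogeneous_def)
    then have "mon_degree m' = 0"
      using cardF[OF H(1)] fin[OF H(1)] unfolding m' by (simp add: mon_degree_add mon_degree_face_mon)
    then show ?thesis using H m' by (auto simp: mon_degree_eq_0)
  qed
  have "(F, G) \<in> {(H, H'). H \<in> facets \<Delta> \<and> H' \<in> facets \<Delta> \<and> H \<union> H' \<subseteq> F \<union> G \<and> adj n H H'}\<^sup>*"
    (is "_ \<in> ?r\<^sup>*") if F: "F \<in> facets \<Delta>" and G: "G \<in> facets \<Delta>" for F G
  proof (rule ccontr)
    assume nFG: "(F, G) \<notin> ?r\<^sup>*"
    define C where "C = {H \<in> facets \<Delta>. (F, H) \<in> ?r\<^sup>*}"
    have "\<exists>p1 p2. g $ j = p1 + p2 \<and> Poly_Mapping.keys p1 \<subseteq> Poly_Mapping.keys (g $ j) \<inter> face_mon ` C \<and>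
        Poly_Mapping.keys p2 \<subseteq> Poly_Mapping.keys (g $ j) - face_mon ` C" for j
      using keys_split[of "g $ j" "face_mon ` C"] by metis
    then obtain g1 g2 where g12: "\<And>j. g $ j = g1 j + g2 j"
      "\<And>j. Poly_Mapping.keys (g1 j) \<subseteq> Poly_Mapping.keys (g $ j) \<inter> face_mon ` C"
      "\<And>j. Poly_Mapping.keys (g2 j) \<subseteq> Poly_Mapping.keys (g $ j) - face_mon ` C"
      by metis
    \<comment> \<open>\<open>P1\<close> is the truncated augmentation and \<open>P2\<close> the
      rest. On syzygies they cancel, so there they have the same monomials.\<close>
    define P1 where "P1 u = (\<Sum>j<b 0. g1 j * u $ j)" for u :: "('v, 'k) mpoly Matrix.vec"
    define P2 where "P2 u = (\<Sum>j<b 0. g2 j * u $ j)" for u :: "('v, 'k) mpoly Matrix.vec"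
    have P12: "g \<bullet> u = P1 u + P2 u" if "u \<in> free_mod V (b 0)" for u
      unfolding gu[OF that] P1_def P2_def g12(1) by (simp add: distrib_right sum.distrib)
    have keys1: "\<exists>H\<in>C. \<exists>c j. j < b 0 \<and> m = face_mon H + c \<and> c \<in> Poly_Mapping.keys (u $ j)"
      if "m \<in> Poly_Mapping.keys (P1 u)" for m u
    proof -
      obtain j where j: "j < b 0" "m \<in> Poly_Mapping.keys (g1 j * u $ j)"
        using \<open>m \<in> _\<close> unfolding P1_def by (auto elim: keys_sum_mem)
      then show ?thesis using keys_mult[of "g1 j" "u $ j"] g12(2)[of j] by blast
    qed
    have keys2: "\<exists>H\<in>facets \<Delta> - C. \<exists>c j. j < b 0 \<and> m = face_mon H + c \<and> c \<in> Poly_Mapping.keys (u $ j)"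
      if "m \<in> Poly_Mapping.keys (P2 u)" for m u
    proof -
      obtain j where j: "j < b 0" "m \<in> Poly_Mapping.keys (g2 j * u $ j)"
        using \<open>m \<in> _\<close> unfolding P2_def by (auto elim: keys_sum_mem)
      then obtain h c where h: "m = h + c" "h \<in> Poly_Mapping.keys (g2 j)" "c \<in> Poly_Mapping.keys (u $ j)"
        using keys_mult[of "g2 j" "u $ j"] by blast
      then have "h \<in> Poly_Mapping.keys (g $ j)" "h \<notin> face_mon ` C" using g12(3) by blast+
      then obtain H where "H \<in> facets \<Delta>" "h = face_mon H" "H \<notin> C" using gkeys[OF j(1)] by blast
      then show ?thesis using h j by blast
    qed
    have face_mon_sub: "H \<subseteq> Poly_Mapping.keys m" if "m = face_mon H + c" "H \<in> facets \<Delta>" for H m and c :: "'v \<Rightarrow>\<^sub>0 nat"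
      using that fin[OF that(2)] by (auto simp: keys_add_nat keys_face_mon)
    let ?N = "face_mon (F \<union> G)"
    have finFG: "finite (F \<union> G)" using F G fin by blast
    \<comment> \<open>All divisors \<open>m\<close> of \<open>?N\<close> are treated at once because
      the coefficients \<open>z $ k\<close> of a general syzygy contribute the factor
      \<open>e\<close>. A monomial common to \<open>P1\<close> and \<open>P2\<close> would contain
      facets \<open>H\<close> in \<open>C\<close> and \<open>H'\<close> outside; its degree
      \<open>n + 1\<close> makes them adjacent.\<close>
    have col: "m \<notin> Poly_Mapping.keys (P1 (col (D 0) k))" if k: "k < b 1" and N: "?N = e + m" for k m e
    proof
      assume m: "m \<in> Poly_Mapping.keys (P1 (col (D 0) k))"
      have "D 0 *\<^sub>v unit_vec (b 1) k = col (D 0) k"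
        using D k by (intro eq_vecI) auto
      then have c: "col (D 0) k \<in> free_mod V (b 0)" "g \<bullet> col (D 0) k = 0"
        using ker unit[of "b 1" k] by (metis (mono_tags, lifting) image_eqI mem_Collect_eq)+
      then have "P2 (col (D 0) k) = - P1 (col (D 0) k)"
        using P12[OF c(1)] by (simp add: eq_neg_iff_add_eq_0 add.commute)
      then have m2: "m \<in> Poly_Mapping.keys (P2 (col (D 0) k))"
        using m by (simp add: in_keys_iff)
      obtain H c j where H: "H \<in> C" "m = face_mon H + c" "j < b 0" "c \<in> Poly_Mapping.keys (col (D 0) k $ j)"
        using keys1[OF m] by blast
      obtain H' c' where H': "H' \<in> facets \<Delta>" "H' \<notin> C" "m = face_mon H' + c'"
        using keys2[OF m2] by blast
      have HF: "H \<in> facets \<Delta>" using H by (simp add: C_def)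
      have "mon_degree c = 1"
        using Dhom[OF H(3) k] H(4) D H(3) k by (auto simp: homogeneous_def)
      then have "mon_degree m = Suc n"
        using H fin[OF HF] card[OF HF] by (simp add: mon_degree_add mon_degree_face_mon)
      then have "card (Poly_Mapping.keys m) \<le> Suc n"
        using card_keys_le_mon_degree[of m] by simp
      moreover have sub: "H \<union> H' \<subseteq> Poly_Mapping.keys m"
        using face_mon_sub[OF H(2) HF] face_mon_sub[OF H'(3,1)] by blast
      then have "card (H \<union> H') \<le> card (Poly_Mapping.keys m)" by (intro card_mono) auto
      moreover have "card H < card (H \<union> H')"
      proof (rule psubset_card_mono)
        show "finite (H \<union> H')" using fin HF H'(1) by blast
        show "H \<subset> H \<union> H'" using facets_subset_eq[OF H'(1) HF] H H' by blast
      qed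
      moreover have "card H + card H' = card (H \<union> H') + card (H \<inter> H')"
        using fin HF H'(1) by (intro card_Un_Int) auto
      ultimately have "adj n H H'"
        using card[OF HF] card[OF H'(1)] by (simp add: adj_def)
      moreover have "Poly_Mapping.keys m \<subseteq> F \<union> G"
        using arg_cong[OF N, of Poly_Mapping.keys] finFG by (auto simp: keys_add_nat keys_face_mon)
      ultimately have "(H, H') \<in> ?r" using HF H' sub by blast
      then have "H' \<in> C" using H(1) H'(1) by (auto simp: C_def intro: rtrancl_into_rtrancl)
      then show False using H' by blast
    qed
    have ker0: "Poly_Mapping.lookup (P1 (D 0 *\<^sub>v z)) ?N = 0" if z: "z \<in> free_mod V (b 1)" for z
    proof -
      have "P1 (D 0 *\<^sub>v z) = (\<Sum>j<b 0. g1 j * (\<Sum>k<b 1. D 0 $$ (j, k) * z $ k))"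
        unfolding P1_def using D z
        by (intro sum.cong) (auto simp: index_mult_mat_vec_sum free_mod_def simp del: index_mult_mat_vec)
      also have "\<dots> = (\<Sum>j<b 0. \<Sum>k<b 1. z $ k * (g1 j * D 0 $$ (j, k)))"
        by (simp add: sum_distrib_left mult_ac)
      also have "\<dots> = (\<Sum>k<b 1. \<Sum>j<b 0. z $ k * (g1 j * D 0 $$ (j, k)))"
        by (rule sum.swap)
      also have "\<dots> = (\<Sum>k<b 1. z $ k * P1 (col (D 0) k))"
        using D by (simp add: P1_def sum_distrib_left)
      finally have eq: "P1 (D 0 *\<^sub>v z) = (\<Sum>k<b 1. z $ k * P1 (col (D 0) k))" .
      have "?N \<notin> Poly_Mapping.keys (P1 (D 0 *\<^sub>v z))"
      proof
        assume "?N \<in> Poly_Mapping.keys (P1 (D 0 *\<^sub>v z))"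
        then obtain k where k: "k < b 1" "?N \<in> Poly_Mapping.keys (z $ k * P1 (col (D 0) k))"
          unfolding eq by (auto elim: keys_sum_mem)
        then show False using keys_mult[of "z $ k" "P1 (col (D 0) k)"] col[OF k(1)] by blast
      qed
      then show ?thesis by (simp add: in_keys_iff)
    qed
    obtain uF uG where uF: "uF \<in> free_mod V (b 0)" "?x F = g \<bullet> uF" and uG: "uG \<in> free_mod V (b 0)" "?x G = g \<bullet> uG"
      using xI[OF F] xI[OF G] I by blast
    \<comment> \<open>The relation between the monomials of \<open>F\<close> and \<open>G\<close>,
      lifted to the free module. The coefficient of \<open>P1 u\<close> at \<open>?N\<close>
      vanishes by \<open>ker0\<close>, but computed directly it is 1: \<open>uF\<close> contributes
      1, \<open>uG\<close> contributes 0.\<close>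
    define u where "u = vec (b 0) (\<lambda>j. ?x (G - F) * uF $ j - ?x (F - G) * uG $ j)"
    have u: "u \<in> free_mod V (b 0)"
      unfolding free_mod_def
    proof (intro CollectI conjI allI impI)
      fix j assume j: "j < b 0"
      show "u $ j \<in> carrier (poly_ring V)"
        using j F G fin sub free_mod_index[OF uF(1) j] free_mod_index[OF uG(1) j] unfolding u_def
        by (simp, intro poly_ring_diff poly_ring_mult single_face_mon_in_poly_ring) auto
    qed (simp add: u_def)
    have lin: "(\<Sum>j<b 0. f j * u $ j) =
        ?x (G - F) * (\<Sum>j<b 0. f j * uF $ j) - ?x (F - G) * (\<Sum>j<b 0. f j * uG $ j)" for f
      by (simp add: u_def sum_distrib_left sum_subtractf[symmetric] algebra_simps)
    have N: "?N = face_mon (G - F) + face_mon F" "?N = face_mon (F - G) + face_mon G"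
      using F G fin face_mon_Un_disjoint[of "G - F" F] face_mon_Un_disjoint[of "F - G" G] by (auto simp: Un_commute)
    have "g \<bullet> u = ?x (G - F) * ?x F - ?x (F - G) * ?x G"
      unfolding gu[OF u] lin uF(2) uG(2) gu[OF uF(1)] gu[OF uG(1)] ..
    also have "\<dots> = 0" using N by (simp add: mult_single)
    finally obtain z where z: "z \<in> free_mod V (b 1)" "u = D 0 *\<^sub>v z"
      using ker u by blast
    have "P1 u = ?x (G - F) * P1 uF - ?x (F - G) * P1 uG"
      unfolding P1_def by (rule lin)
    then have "Poly_Mapping.lookup (P1 u) ?N =
        Poly_Mapping.lookup (?x (G - F) * P1 uF) (face_mon (G - F) + face_mon F) -
        Poly_Mapping.lookup (?x (F - G) * P1 uG) (face_mon (F - G) + face_mon G)"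
      by (simp only: lookup_minus flip: N)
    then have "Poly_Mapping.lookup (P1 uF) (face_mon F) - Poly_Mapping.lookup (P1 uG) (face_mon G) = 0"
      using ker0[OF z(1)] z(2) by (simp only: lookup_single_mult_add mult_1)
    moreover have "face_mon G \<notin> Poly_Mapping.keys (P1 uG)"
    proof
      assume "face_mon G \<in> Poly_Mapping.keys (P1 uG)"
      then obtain H c where H: "H \<in> C" "face_mon G = face_mon H + c" using keys1 by blast
      then have HF: "H \<in> facets \<Delta>" by (simp add: C_def)
      have "H \<subseteq> G" using face_mon_sub[OF H(2) HF] by (simp only: keys_face_mon[OF fin[OF G]])
      then have "H = G" using HF G facets_subset_eq by blast
      then show False using H nFG by (simp add: C_def)
    qed
    moreover have "face_mon F \<notin> Poly_Mapping.keys (P2 uF)"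
    proof
      assume "face_mon F \<in> Poly_Mapping.keys (P2 uF)"
      then obtain H c where H: "H \<in> facets \<Delta>" "H \<notin> C" "face_mon F = face_mon H + c" using keys2 by blast
      have "H \<subseteq> F" using face_mon_sub[OF H(3,1)] by (simp only: keys_face_mon[OF fin[OF F]])
      then have "H = F" using H F facets_subset_eq by blast
      then show False using H F by (simp add: C_def)
    qed
    moreover have "Poly_Mapping.lookup (P1 uF) (face_mon F) + Poly_Mapping.lookup (P2 uF) (face_mon F) = 1"
      using arg_cong[OF P12[OF uF(1)], of "\<lambda>p. Poly_Mapping.lookup p (face_mon F)"]
      unfolding uF(2)[symmetric] by (simp add: lookup_add)
    ultimately show False by (simp add: in_keys_iff)
  qed
  then show ?thesis using card by (intro exI[of _ n] conjI ballI)
qed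

section \<open>Proper chains in trees\<close>

text \<open>Let \<open>G\<close> be the facet from the leaf condition for \<open>L\<close>. A
  neighbour \<open>H\<close> satisfies \<open>L \<inter> H \<subseteq> L \<inter> G\<close>; the
  left side has size \<open>n - 1\<close> and the right side is smaller than \<open>L\<close>. So
  the two coincide and \<open>H\<close> can replace \<open>G\<close>.\<close>

lemma tree_leafy:
  assumes tree: "is_tree V \<Delta>" and n: "\<And>F. F \<in> facets \<Delta> \<Longrightarrow> card F = n"
  shows "leafy n (facets \<Delta>)"
  unfolding leafy_def
proof (intro conjI ballI allI impI)
  have V: "finite V" "\<Delta> \<subseteq> Pow V" using tree by (auto simp: is_tree_def simplicial_complex_def)
  show fin: "finite F" if "F \<in> facets \<Delta>" for F
    using that V by (auto simp: facets_def intro: finite_subset)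
  show "card F = n" if "F \<in> facets \<Delta>" for F using that by (rule n)
  fix T assume T: "T \<subseteq> facets \<Delta>" "T \<noteq> {}"
  \<comment> \<open>The complex generated by \<open>T\<close>, on the smaller vertex set
    \<open>\<Union>T\<close>. Its facets are exactly the members of \<open>T\<close>.\<close>
  define \<Gamma> where "\<Gamma> = {G. \<exists>F\<in>T. G \<subseteq> F}"
  have "\<Union>T \<subseteq> V" using T V by (auto simp: facets_def)
  then have "finite (\<Union>T)" using V finite_subset by blast
  then have "simplicial_complex (\<Union>T) \<Gamma>"
    unfolding simplicial_complex_def \<Gamma>_def by (auto intro: subset_trans)
  moreover have facets: "facets \<Gamma> = T"
  proof (intro equalityI subsetI)
    fix F assume "F \<in> facets \<Gamma>"
    then obtain G where "G \<in> T" "F \<subseteq> G" "G = F" by (fastforce simp: facets_def \<Gamma>_def)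
    then show "F \<in> T" by simp
  next
    fix F assume "F \<in> T"
    moreover have "G = F" if "H \<in> T" "G \<subseteq> H" "F \<subseteq> G" for G H
      using that \<open>F \<in> T\<close> T facets_subset_eq[of F \<Delta> H] by blast
    ultimately show "F \<in> facets \<Gamma>" by (auto simp: facets_def \<Gamma>_def)
  qed
  ultimately have "is_subcomplex \<Gamma> \<Delta>" using T by (auto simp: is_subcomplex_def)
  moreover have "\<Gamma> \<noteq> {}" using T by (auto simp: \<Gamma>_def)
  ultimately obtain L where L: "is_leaf \<Gamma> L" using tree by (auto simp: is_tree_def)
  then have LT: "L \<in> T" by (simp add: is_leaf_def facets)
  have "L \<inter> K \<subseteq> H" if H: "H \<in> T" "adj n L H" and K: "K \<in> T" "K \<noteq> L" for H K
  proof -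
    obtain G where G: "G \<in> T" "G \<noteq> L" "\<And>H. H \<in> T \<Longrightarrow> H \<noteq> L \<Longrightarrow> L \<inter> H \<subseteq> L \<inter> G"
      using L K by (auto simp: is_leaf_def facets)
    have "H \<noteq> L" using H LT T n not_adj_refl[of L n] by auto
    have finL: "finite L" using LT T fin by blast
    have "L \<inter> G \<noteq> L" using facets_subset_eq[of L \<Delta> G] G(1,2) LT T by blast
    then have "card (L \<inter> G) < card L" using finL by (intro psubset_card_mono) auto
    then have "card (L \<inter> G) \<le> card (L \<inter> H)"
      using H LT T n by (auto simp: adj_def subset_iff)
    then have "L \<inter> H = L \<inter> G"
      using G(3)[OF H(1) \<open>H \<noteq> L\<close>] finL by (intro card_seteq) auto
    then show ?thesis using G(3)[OF K] by blast
  qed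
  then show "\<exists>L. pure_leaf n T L" using LT by (auto simp: pure_leaf_def)
qed

text \<open>Consecutive members of a chain must meet, and for \<open>n \<le> 1\<close> sets that
  meet are equal. This excludes codimension-one intersections that are empty.\<close>

lemma connected_facet_card_ge_2:
  assumes "connected_complex \<Delta>" "F \<in> facets \<Delta>" "G \<in> facets \<Delta>" "F \<noteq> G"
    and n: "\<And>F. F \<in> facets \<Delta> \<Longrightarrow> finite F \<and> card F = n"
  shows "2 \<le> n"
proof (rule ccontr)
  assume "\<not> 2 \<le> n"
  obtain c where c: "is_chain \<Delta> F G c" using assms(1-3) unfolding connected_complex_def by blast
  have "c ! i = F" if "i < length c" for i
    using that
  proof (induction i)
    case 0
    then show ?case using c by (simp add: is_chain_def hd_conv_nth)
  next
    case (Suc i)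
    then have ne: "c ! i \<inter> c ! Suc i \<noteq> {}" and "c ! i \<in> facets \<Delta>" "c ! Suc i \<in> facets \<Delta>"
      using c by (auto simp: is_chain_def subset_iff)
    then have *: "finite (c ! i)" "finite (c ! Suc i)" "card (c ! i) = n" "card (c ! Suc i) = n"
      using n by auto
    then have "c ! i \<inter> c ! Suc i = c ! i" "c ! i \<inter> c ! Suc i = c ! Suc i"
      using ne \<open>\<not> 2 \<le> n\<close> card_gt_0_iff[of "c ! i \<inter> c ! Suc i"]
      by (intro card_seteq; auto)+
    then show ?case using Suc by auto
  qed
  then have "G = F" using c by (auto simp: is_chain_def last_conv_nth)
  then show False using assms by simp
qed

section \<open>Proper chains as paths in a tree with facets of size \<open>n\<close>\<close>

locale pure_tree =
  fixes V :: "'v set" and \<Delta> :: "'v set set" and n :: nat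
  assumes tree: "is_tree V \<Delta>" and card_facet: "F \<in> facets \<Delta> \<Longrightarrow> card F = n"
begin

lemma leafy: "leafy n (facets \<Delta>)"
  using tree card_facet by (rule tree_leafy)

lemma finite_facet: "F \<in> facets \<Delta> \<Longrightarrow> finite F"
  using leafy leafy_card by blast

lemma finite_facets: "finite (facets \<Delta>)"
  using tree by (auto simp: is_tree_def simplicial_complex_def facets_def intro: finite_subset[of _ "Pow V"])

lemma ge_2: "F \<in> facets \<Delta> \<Longrightarrow> G \<in> facets \<Delta> \<Longrightarrow> F \<noteq> G \<Longrightarrow> 2 \<le> n"
  using connected_facet_card_ge_2[of \<Delta> F G n] tree finite_facet card_facet by (auto simp: is_tree_def)

text \<open>Distinct ends give \<open>n \<ge> 2\<close>. Then an intersection of size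
  \<open>n - 1\<close> is nonempty, and both chain conditions reduce to adjacency.\<close>

lemma proper_chain_iff:
  assumes "F \<noteq> G"
  shows "proper_chain \<Delta> F G c \<longleftrightarrow>
    c \<noteq> [] \<and> set c \<subseteq> facets \<Delta> \<and> hd c = F \<and> last c = G \<and> successively (adj n) c"
proof (cases "c \<noteq> [] \<and> set c \<subseteq> facets \<Delta> \<and> hd c = F \<and> last c = G")
  case True
  then have "F \<in> facets \<Delta>" "G \<in> facets \<Delta>" by auto
  then have n: "2 \<le> n" using ge_2 assms by blast
  have "(c ! i \<inter> c ! Suc i \<noteq> {} \<and> face_dim (c ! i \<inter> c ! Suc i) = face_dim (c ! Suc i) - 1) \<longleftrightarrow>
      adj n (c ! i) (c ! Suc i)" if "Suc i < length c" for i
  proof -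
    have "c ! Suc i \<in> facets \<Delta>" using True that by auto
    then have "card (c ! Suc i) = n" by (rule card_facet)
    then show ?thesis using n by (auto simp: face_dim_def adj_def)
  qed
  then show ?thesis
    using True unfolding proper_chain_def is_chain_def successively_conv_nth by blast
qed (auto simp: proper_chain_def is_chain_def)

lemma irredundant_induced:
  assumes c: "irredundant_proper_chain \<Delta> F G c" and "F \<noteq> G"
  shows "induced_path n c"
proof -
  have pc: "c \<noteq> []" "set c \<subseteq> facets \<Delta>" "hd c = F" "last c = G" "successively (adj n) c"
    using c proper_chain_iff[OF \<open>F \<noteq> G\<close>] by (auto simp: irredundant_proper_chain_def)
  \<comment> \<open>Cutting out everything strictly between \<open>i\<close> and \<open>k\<close>
    leaves a proper subsequence. The case \<open>k = length c\<close> stops at position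
    \<open>i\<close>; it arises when the last facet is repeated.\<close>
  have shortcut: False if i: "i < length c" and k: "Suc i < k" "k \<le> length c"
    and link: "k < length c \<Longrightarrow> adj n (c ! i) (c ! k)" "k = length c \<Longrightarrow> c ! i = G" for i k
  proof -
    let ?c = "take (Suc i) c @ drop k c"
    have "hd ?c = F" using pc by (simp add: hd_append hd_take)
    moreover have "last (take (Suc i) c) = c ! i"
      using i by (simp add: take_Suc_conv_app_nth)
    then have "last ?c = G" using link(2) k pc(4) by (auto simp: last_append)
    moreover have "successively (adj n) (take (Suc i) c)" "successively (adj n) (drop k c)"
      using pc(5) successively_append_iff[of "adj n" "take (Suc i) c" "drop (Suc i) c"]
        successively_append_iff[of "adj n" "take k c" "drop k c"] by auto
    then have "successively (adj n) ?c"
      unfolding successively_append_iff \<open>last (take (Suc i) c) = c ! i\<close>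
      using link(1) k by (cases "k = length c") (auto simp: hd_drop_conv_nth)
    moreover have "set ?c \<subseteq> facets \<Delta>"
      using pc(2) by (auto dest: in_set_takeD in_set_dropD)
    ultimately have "proper_chain \<Delta> F G ?c"
      using proper_chain_iff[OF \<open>F \<noteq> G\<close>] pc(1) by simp
    moreover have "subseq ?c (take k c @ drop k c)"
    proof (rule list_emb_append_mono)
      have "take (Suc i) c = take (Suc i) (take k c)" using k by (simp add: min_absorb1)
      then show "subseq (take (Suc i) c) (take k c)"
        by (metis prefix_imp_subseq take_is_prefix)
    qed simp
    ultimately have "?c = c" using c by (simp add: irredundant_proper_chain_def)
    then have "length ?c = length c" by simp
    then show False using i k by simp
  qed
  show ?thesis
    unfolding induced_path_def
  proof (intro conjI allI impI)
    show "c \<noteq> []" by (rule pc)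
    have "c ! i \<noteq> c ! j" if ij: "i < j" "j < length c" for i j
    proof
      assume eq: "c ! i = c ! j"
      show False
      proof (rule shortcut[of i "Suc j"])
        show "adj n (c ! i) (c ! Suc j)" if "Suc j < length c"
          using pc(5) that eq by (simp add: successively_conv_nth)
        show "c ! i = G" if "Suc j = length c"
          using that eq pc(1,4) by (metis last_conv_nth diff_Suc_1)
      qed (use ij in auto)
    qed
    then show "distinct c" by (simp add: distinct_conv_nth) (metis nat_neq_iff)
    fix i j assume ij: "i < j" "j < length c"
    show "adj n (c ! i) (c ! j) \<longleftrightarrow> j = Suc i"
    proof
      assume "adj n (c ! i) (c ! j)"
      then show "j = Suc i" using shortcut[of i j] ij by fastforce
    qed (use pc(5) ij in \<open>simp add: successively_conv_nth\<close>)
  qed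
qed

text \<open>Take a shortest proper chain inside \<open>T\<close>. Its subsequences stay inside
  \<open>T\<close>, so it is irredundant among all proper chains.\<close>

lemma irredundant_exists:
  assumes "F \<noteq> G" "T \<subseteq> facets \<Delta>"
    and c: "c \<noteq> []" "set c \<subseteq> T" "hd c = F" "last c = G" "successively (adj n) c"
  obtains c' where "irredundant_proper_chain \<Delta> F G c'" "set c' \<subseteq> T"
proof -
  let ?P = "\<lambda>c. proper_chain \<Delta> F G c \<and> set c \<subseteq> T"
  have "?P c" using assms proper_chain_iff[OF assms(1)] by blast
  then obtain c' where c': "?P c'" "\<And>c. ?P c \<Longrightarrow> length c' \<le> length c"
    using ex_has_least_nat[of ?P c length] by blast
  have "c'' = c'" if "subseq c'' c'" "proper_chain \<Delta> F G c''" for c''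
  proof -
    have "set c'' \<subseteq> T" using that(1) c'(1) by (auto simp: subseq_conv_nths dest: in_set_nthsD)
    then have "length c' \<le> length c''" using c'(2) that by blast
    then show ?thesis
      using that(1) list_emb_length subseq_same_length by (metis order_antisym)
  qed
  then show ?thesis using c'(1) that[of c'] by (simp add: irredundant_proper_chain_def)
qed

lemma facet_dist_eq:
  assumes "F \<noteq> G" and c: "irredundant_proper_chain \<Delta> F G c"
  shows "facet_dist \<Delta> F G = length c - 1"
proof -
  have props: "induced_path n c'" "set c' \<subseteq> facets \<Delta>" "hd c' = F" "last c' = G"
    if "irredundant_proper_chain \<Delta> F G c'" for c'
    using that irredundant_induced[OF that assms(1)] proper_chain_iff[OF assms(1)]
    by (auto simp: irredundant_proper_chain_def)
  have "(THE c. irredundant_proper_chain \<Delta> F G c) = c"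
    using c props induced_path_unique[OF finite_facets leafy]
    by (intro the_equality) metis+
  then show ?thesis by (simp add: facet_dist_def chain_length_def)
qed

lemma complex_dim_eq: "F \<in> facets \<Delta> \<Longrightarrow> complex_dim \<Delta> = int n - 1"
proof -
  assume "F \<in> facets \<Delta>"
  then have "face_dim ` facets \<Delta> = {int n - 1}" using card_facet by (auto simp: face_dim_def)
  then show ?thesis by (simp add: complex_dim_def)
qed

lemma card_Diff_facets:
  assumes "F \<in> facets \<Delta>" "G \<in> facets \<Delta>"
  shows "card (F \<inter> G) + card (G - F) = n"
  using assms card_Int_Diff[of G F] finite_facet card_facet by (simp add: Int_commute)

text \<open>A walk inside \<open>F \<union> G\<close> contains an irredundant chain inside
  \<open>F \<union> G\<close>. Uniqueness of irredundant chains makes the length of this one the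
  distance.\<close>

lemma intersection_propertyI:
  assumes conn: "\<And>F G. F \<in> facets \<Delta> \<Longrightarrow> G \<in> facets \<Delta> \<Longrightarrow>
      (F, G) \<in> {(H, H'). H \<in> facets \<Delta> \<and> H' \<in> facets \<Delta> \<and> H \<union> H' \<subseteq> F \<union> G \<and> adj n H H'}\<^sup>*"
  shows "intersection_property V \<Delta>"
proof -
  have ex: "\<exists>c. irredundant_proper_chain \<Delta> F G c \<and> length c = Suc (card (G - F))"
    if F: "F \<in> facets \<Delta>" and G: "G \<in> facets \<Delta>" and ne: "F \<noteq> G" for F G
  proof -
    let ?T = "{H \<in> facets \<Delta>. H \<subseteq> F \<union> G}"
    have "\<exists>c. c \<noteq> [] \<and> set c \<subseteq> ?T \<and> hd c = F \<and> last c = H \<and> successively (adj n) c"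
      if "(F, H) \<in> {(H, H'). H \<in> facets \<Delta> \<and> H' \<in> facets \<Delta> \<and> H \<union> H' \<subseteq> F \<union> G \<and> adj n H H'}\<^sup>*" for H
      using that
    proof (induction rule: rtrancl_induct)
      case base
      show ?case using F by (intro exI[of _ "[F]"]) auto
    next
      case (step H H')
      then obtain c where "c \<noteq> []" "set c \<subseteq> ?T" "hd c = F" "last c = H" "successively (adj n) c" by blast
      then show ?case using step.hyps(2)
        by (intro exI[of _ "c @ [H']"]) (auto simp: successively_append_iff)
    qed
    from this[OF conn[OF F G]] obtain c where
      c: "c \<noteq> []" "set c \<subseteq> ?T" "hd c = F" "last c = G" "successively (adj n) c" by blast
    obtain c' where c': "irredundant_proper_chain \<Delta> F G c'" "set c' \<subseteq> ?T"
      by (rule irredundant_exists[OF ne _ c]) auto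
    have "hd c' = F" "last c' = G" "set c' \<subseteq> facets \<Delta>"
      using c' proper_chain_iff[OF ne] by (auto simp: irredundant_proper_chain_def)
    then have "length c' = Suc (card (G - F))"
      using induced_path_length[OF leafy irredundant_induced[OF c'(1) ne]] c'(2) by auto
    then show ?thesis using c' by blast
  qed
  have "connected_codim_one \<Delta>"
    unfolding connected_codim_one_def
  proof (intro ballI impI)
    fix F G assume "F \<in> facets \<Delta>" "G \<in> facets \<Delta>"
    then show "\<exists>c. proper_chain \<Delta> F G c"
      using ex[of F G] by (cases "F = G")
        (auto simp: irredundant_proper_chain_def proper_chain_def is_chain_def intro: exI[of _ "[F]"])
  qed
  moreover have "facet_dist \<Delta> F G = k"
    if FG: "F \<in> facets \<Delta>" "G \<in> facets \<Delta>" and k: "1 \<le> k" "face_dim (F \<inter> G) = complex_dim \<Delta> - int k"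
    for F G k
  proof -
    have "card (G - F) = k"
      using k card_Diff_facets[OF FG] complex_dim_eq[OF FG(1)] by (simp add: face_dim_def)
    moreover from this k have "F \<noteq> G" by auto
    moreover from this obtain c where "irredundant_proper_chain \<Delta> F G c" "length c = Suc (card (G - F))"
      using ex[OF FG] by blast
    ultimately show ?thesis using facet_dist_eq[of F G c] by simp
  qed
  moreover have "pure_complex \<Delta>" using card_facet by (simp add: pure_complex_def face_dim_def)
  ultimately show ?thesis using tree by (simp add: intersection_property_def)
qed

text \<open>The property is applied with \<open>k = card (G - F)\<close>, which is positive because
  no facet contains another and is at most \<open>n\<close>, that is,
  \<open>complex_dim \<Delta> + 1\<close>.\<close>

lemma intersection_property_path:
  assumes ip: "intersection_property V \<Delta>" and FG: "F \<in> facets \<Delta>" "G \<in> facets \<Delta>" "F \<noteq> G"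
  shows "\<exists>P. induced_path n P \<and> set P \<subseteq> facets \<Delta> \<and> hd P = F \<and> last P = G \<and>
    length P = Suc (card (G - F))"
proof -
  have "face_dim F = face_dim G" using FG card_facet by (simp add: face_dim_def)
  moreover have "connected_codim_one \<Delta>"
    using ip unfolding intersection_property_def by (elim conjE)
  ultimately obtain c where "proper_chain \<Delta> F G c"
    using FG(1,2) unfolding connected_codim_one_def by (metis order_refl)
  then have c: "c \<noteq> []" "set c \<subseteq> facets \<Delta>" "hd c = F" "last c = G" "successively (adj n) c"
    using proper_chain_iff[OF FG(3)] by auto
  obtain P where P: "irredundant_proper_chain \<Delta> F G P"
    by (rule irredundant_exists[OF FG(3) order_refl c])
  then have P': "P \<noteq> []" "set P \<subseteq> facets \<Delta>" "hd P = F" "last P = G"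
    using proper_chain_iff[OF FG(3)] by (auto simp: irredundant_proper_chain_def)
  have "G - F \<noteq> {}" using FG facets_subset_eq by blast
  then have pos: "1 \<le> card (G - F)" using finite_facet[OF FG(2)] by (simp add: Suc_le_eq card_gt_0_iff)
  have "facet_dist \<Delta> F G = card (G - F)"
  proof -
    have "\<forall>F\<in>facets \<Delta>. \<forall>G\<in>facets \<Delta>. \<forall>k::nat.
        1 \<le> k \<and> int k \<le> complex_dim \<Delta> + 1 \<and> face_dim (F \<inter> G) = complex_dim \<Delta> - int k \<longrightarrow>
        facet_dist \<Delta> F G = k"
      using ip unfolding intersection_property_def by (elim conjE)
    from this[rule_format, OF FG(1,2), of "card (G - F)"] show ?thesis
      using pos card_Diff_facets[OF FG(1,2)] complex_dim_eq[OF FG(1)] by (simp add: face_dim_def)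
  qed
  then have "length P = Suc (card (G - F))"
    using facet_dist_eq[OF FG(3) P] P'(1) by (cases P) auto
  then show ?thesis using irredundant_induced[OF P FG(3)] P' by blast
qed

end

section \<open>Ordering the facets, and the equivalence\<close>

text \<open>A leaf \<open>L\<close> is put last. The path hypothesis survives in
  \<open>S - {L}\<close> because paths between other facets avoid \<open>L\<close>.\<close>

lemma linear_quotients_exist:
  assumes "finite S" "leafy n S"
    and "\<And>F G. F \<in> S \<Longrightarrow> G \<in> S \<Longrightarrow> F \<noteq> G \<Longrightarrow>
      \<exists>P. induced_path n P \<and> set P \<subseteq> S \<and> hd P = F \<and> last P = G \<and> length P = Suc (card (G - F))"
  shows "\<exists>fs. set fs = S \<and>
    (\<forall>i j. j < i \<longrightarrow> i < length fs \<longrightarrow> (\<exists>l<i. \<exists>w\<in>fs ! j. fs ! l - fs ! i = {w}))"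
  using assms
proof (induction "card S" arbitrary: S)
  case 0
  then show ?case by (intro exI[of _ "[]"]) auto
next
  case (Suc k)
  then have "S \<noteq> {}" by auto
  then obtain L where L: "pure_leaf n S L" using leafy_pure_leaf[OF Suc.prems(2) order_refl] by blast
  then have LS: "L \<in> S" by (simp add: pure_leaf_def)
  have "\<exists>fs. set fs = S - {L} \<and>
      (\<forall>i j. j < i \<longrightarrow> i < length fs \<longrightarrow> (\<exists>l<i. \<exists>w\<in>fs ! j. fs ! l - fs ! i = {w}))"
  proof (rule Suc.hyps(1))
    fix F G assume FG: "F \<in> S - {L}" "G \<in> S - {L}" "F \<noteq> G"
    then obtain P where P: "induced_path n P" "set P \<subseteq> S" "hd P = F" "last P = G" "length P = Suc (card (G - F))"
      using Suc.prems(3)[of F G] by blast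
    then have "L \<notin> set P"
      using induced_path_avoids_leaf[OF Suc.prems(2) order_refl P(1,2) L] FG by auto
    then show "\<exists>P. induced_path n P \<and> set P \<subseteq> S - {L} \<and> hd P = F \<and> last P = G \<and> length P = Suc (card (G - F))"
      using P by blast
  qed (use Suc.hyps(2) Suc.prems LS in \<open>auto intro: leafy_subset\<close>)
  then obtain fs where fs: "set fs = S - {L}"
    "\<And>i j. j < i \<Longrightarrow> i < length fs \<Longrightarrow> \<exists>l<i. \<exists>w\<in>fs ! j. fs ! l - fs ! i = {w}" by blast
  let ?gs = "fs @ [L]"
  have "\<exists>l<i. \<exists>w\<in>?gs ! j. ?gs ! l - ?gs ! i = {w}" if ij: "j < i" "i < length ?gs" for i j
  proof (cases "i < length fs")
    case True
    then obtain l w where "l < i" "w \<in> fs ! j" "fs ! l - fs ! i = {w}" using fs(2) ij by blast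
    then show ?thesis using True ij by (intro exI[of _ l]) (auto simp: nth_append)
  next
    case False
    then have i: "i = length fs" using ij by simp
    then have "fs ! j \<in> S - {L}" using ij fs(1) nth_mem by blast
    then obtain P where P: "induced_path n P" "set P \<subseteq> S" "hd P = L" "last P = fs ! j"
      "length P = Suc (card (fs ! j - L))"
      using Suc.prems(3)[of L "fs ! j"] LS by blast
    \<comment> \<open>The first facet \<open>H\<close> after \<open>L\<close> on the path to
      \<open>fs ! j\<close> is the required \<open>fs ! l\<close>: it precedes \<open>L\<close> in
      the list because every other facet does, and its new vertex lies in
      \<open>fs ! j\<close>.\<close>
    have "length P = Suc (card (last P - hd P))" "hd P \<noteq> last P"
      using P \<open>fs ! j \<in> S - {L}\<close> by auto
    then obtain H w where "H \<in> set P" "H \<noteq> hd P" "adj n (hd P) H" "H - hd P = {w}" "w \<in> last P"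
      by (rule induced_path_first_step[OF Suc.prems(2) P(1,2)])
    then have H: "H \<in> set P" "H \<noteq> L" "H - L = {w}" "w \<in> fs ! j"
      unfolding P(3,4) by blast+
    then have "H \<in> set fs" using P(2) fs(1) by blast
    then obtain l where "l < length fs" "fs ! l = H" by (metis in_set_conv_nth)
    then show ?thesis using i ij H by (intro exI[of _ l]) (auto simp: nth_append)
  qed
  moreover have "set ?gs = S" using fs(1) LS by auto
  ultimately show ?case by blast
qed

theorem theorem3p17:
  fixes V :: "'v set" and \<Delta> :: "'v set set"
  assumes "is_tree V \<Delta>"
  shows "linear_tree TYPE('k::field) V \<Delta> \<longleftrightarrow> intersection_property V \<Delta>"
proof
  have sc: "simplicial_complex V \<Delta>" using assms by (simp add: is_tree_def)
  {
    assume "linear_tree TYPE('k) V \<Delta>"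
    then have "has_linear_resolution V (facet_ideal V \<Delta> :: ('v, 'k) mpoly set)"
      by (simp add: linear_tree_def)
    from linear_resolution_facets[OF sc this] obtain n
      where card: "\<forall>F\<in>facets \<Delta>. card F = n"
      and conn: "\<forall>F\<in>facets \<Delta>. \<forall>G\<in>facets \<Delta>.
        (F, G) \<in> {(H, H'). H \<in> facets \<Delta> \<and> H' \<in> facets \<Delta> \<and> H \<union> H' \<subseteq> F \<union> G \<and> adj n H H'}\<^sup>*"
      by (elim exE conjE)
    interpret pure_tree V \<Delta> n by unfold_locales (use assms card in auto)
    show "intersection_property V \<Delta>" using conn by (intro intersection_propertyI) blast
  next
    assume ip: "intersection_property V \<Delta>"
    then have pure: "pure_complex \<Delta>" by (simp add: intersection_property_def)
    have "card F = card G" if "F \<in> facets \<Delta>" "G \<in> facets \<Delta>" for F G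
      using pure[unfolded pure_complex_def face_dim_def, rule_format, OF that] by simp
    then obtain n where card: "\<And>F. F \<in> facets \<Delta> \<Longrightarrow> card F = n" by metis
    interpret pure_tree V \<Delta> n using assms card by unfold_locales
    have "\<exists>fs. set fs = facets \<Delta> \<and>
        (\<forall>i j. j < i \<longrightarrow> i < length fs \<longrightarrow> (\<exists>l<i. \<exists>w\<in>fs ! j. fs ! l - fs ! i = {w}))"
      using finite_facets leafy intersection_property_path[OF ip] by (rule linear_quotients_exist)
    then obtain fs where fs: "set fs = facets \<Delta>"
      "\<forall>i j. j < i \<longrightarrow> i < length fs \<longrightarrow> (\<exists>l<i. \<exists>w\<in>fs ! j. fs ! l - fs ! i = {w})"
      by (elim exE conjE)
    have "has_linear_resolution V (facet_ideal V \<Delta> :: ('v, 'k) mpoly set)"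
      by (rule has_linear_resolution_linear_quotients[OF sc fs(1) card]) (use fs(2) in auto)
    then show "linear_tree TYPE('k) V \<Delta>" using assms by (simp add: linear_tree_def)
  }
qed

end
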